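(* Let $k,\ell$ be positive integers and, for $1\le i\le k$ and $0\le j\le \ell$, let $x_{i,j}$ be fixed rational numbers. For every positive integer $n$ set $$s_n := \sum_{i=1}^k \prod_{j=0}^{\ell} x_{i,j}^{\,n^j}.$$ Then the following are equivalent: (a) There is a real number $\theta>1$ such that $\omega(s_n) > \mathrm{slog}_\theta(n)$ for infinitely many integers $n\ge 2$. (b) $\limsup_{n\to\infty}\omega(s_n)=\infty$. (c) There do not exist non-zero rationals $a_0,b_0,\ldots,a_\ell,b_\ell$ such that $s_{2n}=\prod_{j=0}^{\ell} a_j^{(2n)^j}$ and $s_{2n-1}=\prod_{j=0}^{\ell} b_j^{(2n-1)^j}$ for all positive integers $n$.
   Context: For a non-zero integer $x$, $\omega(x)$ is the number of distinct (positive) prime divisors of $x$, and $\omega(0):=\infty$. For $x\in\mathbf Z$ and a positive integer $y$, one sets $\omega(x/y):=\omega(x/\delta)+\omega(y/\delta)$ where $\delta=\gcd(x,y)$; in particular $\omega$ is a function on $\mathbf Q$ with values in $\mathbf N\cup\{\infty\}$. For a real $\theta>1$, define $\theta^{\otimes 0}:=1$ and $\theta^{\otimes\kappa}:=\theta^{\theta^{\otimes(\kappa-1)}}$ for integers $\kappa\ge 1$. For an integer $n\ge 2$, the super-logarithm $\mathrm{slog}_\theta(n)$ is the largest integer $\kappa\ge 0$ such that $\theta^{\otimes\kappa}\le n$; if no largest such $\kappa$ exists (which can occur only when $\theta\le e^{1/e}$), it is understood that $\mathrm{slog}_\theta(n)=\infty$, so that the inequality in (a) fails for such $n$. *)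

theory Defs
  imports
    Complex_Main
    "HOL-Library.Extended_Nat"
    "HOL-Library.Liminf_Limsup"
    "HOL-Computational_Algebra.Primes"
begin

(* prime_factors over int yields normalised, hence positive, primes. *)
definition omega_int :: "int \<Rightarrow> enat" where
  "omega_int x = (if x = 0 then \<infinity> else enat (card (prime_factors x)))"

(* quotient_of gives numerator and positive denominator in lowest terms;
   see omega_rat_divide for the formula on an arbitrary representation x/y. *)
definition omega_rat :: "rat \<Rightarrow> enat" where
  "omega_rat r = omega_int (fst (quotient_of r)) + omega_int (snd (quotient_of r))"

lemma omega_rat_divide:
  fixes x y :: int
  assumes "y > 0"
  shows "omega_rat (of_int x / of_int y) =
    omega_int (x div gcd x y) + omega_int (y div gcd x y)"
  using assms
  by (simp add: omega_rat_def Fract_of_int_quotient [symmetric] quotient_of_Fract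
      Rat.normalize_def Let_def)

primrec tower :: "real \<Rightarrow> nat \<Rightarrow> real" where
  "tower \<theta> 0 = 1"
| "tower \<theta> (Suc \<kappa>) = \<theta> powr tower \<theta> \<kappa>"

(* Only meant for n \<ge> 1: the set then contains 0, so a largest element exists
   iff the set is finite. *)
definition slog :: "real \<Rightarrow> nat \<Rightarrow> enat" where
  "slog \<theta> n =
    (if finite {\<kappa>. tower \<theta> \<kappa> \<le> real n}
     then enat (Max {\<kappa>. tower \<theta> \<kappa> \<le> real n})
     else \<infinity>)"

definition superpower_sum :: "nat \<Rightarrow> nat \<Rightarrow> (nat \<Rightarrow> nat \<Rightarrow> rat) \<Rightarrow> nat \<Rightarrow> rat" where
  "superpower_sum k l x n = (\<Sum>i=1..k. \<Prod>j=0..l. x i j ^ (n ^ j))"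

end

theory Submission
  imports Defs "HOL-Number_Theory.Number_Theory" "HOL-Real_Asymp.Real_Asymp"
begin

text \<open>
  The hard implication is that \<open>\<omega>(s\<^sub>n)\<close> grows at tower speed along some sequence of indices unless \<open>s\<close>
  is a single superpower on each of the two parity classes; the other two are soft, because
  \<open>slog\<^sub>\<theta>(n)\<close> tends to infinity and because a single superpower has only the primes of its bases.
  The argument is elementary, a comparison of archimedean and \<open>p\<close>-adic sizes followed by a congruence.
  
  Fix a parity class. There the signs of the \<open>x\<^sub>i\<^sub>j\<close> with \<open>j \<ge> 1\<close> contribute a constant factor, so terms with
  equal absolute values \<open>\<bar>x\<^sub>i\<^sub>j\<bar>\<close> for all \<open>j \<ge> 1\<close> can be merged (lemma \<open>superpower_sum_on_parity_class\<close>).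
  If nothing is left, \<open>s\<close> vanishes on the class and \<open>\<omega>\<close> is infinite; if one term is left, \<open>s\<close> is a
  superpower there. Otherwise, clearing denominators turns \<open>s\<close> into \<open>S(n) = \<Sum>\<^sub>i c\<^sub>i T\<^sub>i(n)\<close> with at least
  two terms, non-zero integers \<open>c\<^sub>i\<close> and \<open>T\<^sub>i(n) = \<Prod>\<^sub>j w\<^sub>i\<^sub>j^(n^j)\<close> for distinct vectors of positive
  integers \<open>w\<^sub>i\<close>.
  Let \<open>P\<close> be the finite set of primes dividing a base or the denominator, and \<open>g(n)\<close> the gcd of the \<open>T\<^sub>i(n)\<close>.
  
  \<^item> The largest term \<open>T\<^sub>m\<close> beats any other \<open>T\<^sub>i\<close> by a factor \<open>e^(\<epsilon>n)\<close>, since \<open>ln T\<^sub>m - ln T\<^sub>i\<close> is a polynomial in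
    \<open>n\<close> without constant term. As \<open>g(n) \<le> T\<^sub>i(n)\<close>, it follows that \<open>\<bar>S(n)\<bar>/g(n)\<close> tends to infinity
    (lemma \<open>sum_outgrows_gcd\<close>).
  \<^item> For a prime \<open>p\<close>, the terms of least \<open>p\<close>-adic valuation have a sum that, freed from its power of
    \<open>p\<close>, is again a sum of superpowers, hence eventually non-zero, and periodic modulo powers of \<open>p\<close>. So along a
    suitable arithmetic progression \<open>p\<close> occurs in \<open>S(n)/g(n)\<close> to bounded order only
    (lemma \<open>multiplicity_in_progression\<close>).
  
  Together: along a progression, the part \<open>r(n)\<close> of \<open>S(n)\<close> outside \<open>P\<close> satisfies \<open>n \<le> K r(n)\<close>. Now move from
  \<open>n\<close> to an \<open>n'\<close> in the progression with \<open>n' \<equiv> n\<close> modulo \<open>\<phi>(r(n)\<^sup>2)\<close> and \<open>n' > K r(n)\<close>. Then \<open>S(n') \<equiv> S(n)\<close> modulo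
  \<open>r(n)\<^sup>2\<close>, so the primes of \<open>r(n)\<close> divide \<open>S(n')\<close> to the same order; were there no others outside \<open>P\<close>,
  \<open>r(n')\<close> would divide \<open>r(n)\<close>, which is too small (lemma \<open>new_prime_nearby\<close>). One exponential in
  \<open>n^l\<close> thus buys one new prime, and iterating gives the tower (lemma \<open>many_primes_at_tower_speed\<close>).
\<close>

section \<open>Growth of polynomials without constant term\<close>

text \<open>
  The leading term decides; as there is no constant term, its degree is at least one, and a linear bound
  results.
\<close>

lemma polynomial_at_least_linear:
  fixes a :: "nat \<Rightarrow> real"
  assumes "\<exists>j\<in>{1..l}. a j \<noteq> 0"
  obtains \<epsilon> where "\<epsilon> > 0"
    "(\<forall>\<^sub>F n in sequentially. (\<Sum>j=1..l. a j * real n ^ j) \<ge> \<epsilon> * real n) \<or>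
     (\<forall>\<^sub>F n in sequentially. (\<Sum>j=1..l. a j * real n ^ j) \<le> - \<epsilon> * real n)"
proof -
  \<comment> \<open>the degree of the polynomial\<close>
  define d where "d = Max {j\<in>{1..l}. a j \<noteq> 0}"
  have ne: "{j\<in>{1..l}. a j \<noteq> 0} \<noteq> {}" using assms by auto
  have d: "d \<in> {1..l}" "a d \<noteq> 0" using Max_in[OF _ ne] by (auto simp: d_def)
  have zero: "a j = 0" if "j \<in> {1..l}" "j > d" for j
  proof (rule ccontr)
    assume "a j \<noteq> 0"
    then have "j \<le> d" unfolding d_def using that by (intro Max_ge) auto
    then show False using that by simp
  qed
  have "(\<lambda>n. \<Sum>j=1..l. a j * real n ^ j / real n ^ d) \<longlonglongrightarrow> (\<Sum>j=1..l. if j = d then a d else 0)"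
  proof (rule tendsto_sum)
    fix j assume j: "j \<in> {1..l}"
    consider "j < d" | "j = d" | "j > d" by linarith
    then show "(\<lambda>n. a j * real n ^ j / real n ^ d) \<longlonglongrightarrow> (if j = d then a d else 0)"
    proof cases
      case 1
      have "(\<lambda>n. a j * inverse (real n ^ (d - j))) \<longlonglongrightarrow> a j * 0"
        using 1 by (intro tendsto_intros tendsto_inverse_0_at_top filterlim_pow_at_top
            filterlim_real_sequentially) auto
      moreover have "\<forall>\<^sub>F n in sequentially. a j * inverse (real n ^ (d - j)) = a j * real n ^ j / real n ^ d"
        using eventually_gt_at_top[of 0] by eventually_elim (use 1 in \<open>simp add: power_diff field_simps\<close>)
      ultimately show ?thesis using 1 by (simp add: tendsto_cong)
    next
      case 2
      have "\<forall>\<^sub>F n in sequentially. a d = a j * real n ^ j / real n ^ d"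
        using eventually_gt_at_top[of 0] by eventually_elim (use 2 in simp)
      then show ?thesis using 2 by (simp add: tendsto_eventually eventually_mono)
    qed (use zero j in auto)
  qed
  then have "(\<lambda>n. (\<Sum>j=1..l. a j * real n ^ j) / real n ^ d) \<longlonglongrightarrow> a d"
    using d by (simp add: sum_divide_distrib)
  then have "\<forall>\<^sub>F n in sequentially. dist ((\<Sum>j=1..l. a j * real n ^ j) / real n ^ d) (a d) < \<bar>a d\<bar> / 2"
    using d by (intro tendstoD) auto
  moreover have "\<forall>\<^sub>F n::nat in sequentially. n > 0" by (rule eventually_gt_at_top)
  ultimately have ev: "\<forall>\<^sub>F n in sequentially. n > 0 \<and>
      \<bar>(\<Sum>j=1..l. a j * real n ^ j) / real n ^ d - a d\<bar> < \<bar>a d\<bar> / 2"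
    by eventually_elim (simp add: dist_real_def)
  have lin: "real n \<le> real n ^ d" if "n > 0" for n
    using that d by (intro self_le_power) auto
  show ?thesis
  proof (cases "a d > 0")
    case True
    have "\<forall>\<^sub>F n in sequentially. (\<Sum>j=1..l. a j * real n ^ j) \<ge> a d / 2 * real n"
      using ev
    proof eventually_elim
      case (elim n)
      then have "a d / 2 \<le> (\<Sum>j=1..l. a j * real n ^ j) / real n ^ d" using True by linarith
      then have "a d / 2 * real n ^ d \<le> (\<Sum>j=1..l. a j * real n ^ j)" using elim by (simp add: field_simps)
      moreover have "a d / 2 * real n \<le> a d / 2 * real n ^ d"
        using lin elim True by (intro mult_left_mono) auto
      ultimately show ?case by linarith
    qed
    then show ?thesis using that[of "a d / 2"] True by auto
  next
    case False
    have "\<forall>\<^sub>F n in sequentially. (\<Sum>j=1..l. a j * real n ^ j) \<le> - (- a d / 2) * real n"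
      using ev
    proof eventually_elim
      case (elim n)
      then have "(\<Sum>j=1..l. a j * real n ^ j) / real n ^ d \<le> a d / 2" using False by linarith
      then have "(\<Sum>j=1..l. a j * real n ^ j) \<le> a d / 2 * real n ^ d" using elim by (simp add: field_simps)
      moreover have "a d / 2 * real n ^ d \<le> a d / 2 * real n"
        using lin elim False by (intro mult_left_mono_neg) auto
      ultimately show ?case by simp
    qed
    then show ?thesis using that[of "- a d / 2"] False d by auto
  qed
qed

text \<open>
  Sequences that are pairwise eventually comparable are totally preordered, and a finite total preorder
  has a greatest element.
\<close>

lemma eventually_greatest_exists:
  fixes f :: "'i \<Rightarrow> nat \<Rightarrow> real"
  assumes "finite I" "I \<noteq> {}"
    and "\<And>i i'. i \<in> I \<Longrightarrow> i' \<in> I \<Longrightarrow>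
      (\<forall>\<^sub>F n in sequentially. f i n \<le> f i' n) \<or> (\<forall>\<^sub>F n in sequentially. f i' n \<le> f i n)"
  shows "\<exists>m\<in>I. \<forall>i\<in>I. \<forall>\<^sub>F n in sequentially. f i n \<le> f m n"
  using assms
proof (induction I rule: finite_ne_induct)
  case (singleton i)
  then show ?case by simp
next
  case (insert i0 I)
  then obtain m where m: "m \<in> I" "\<And>i. i \<in> I \<Longrightarrow> \<forall>\<^sub>F n in sequentially. f i n \<le> f m n"
    by (metis insert_iff)
  have "(\<forall>\<^sub>F n in sequentially. f i0 n \<le> f m n) \<or> (\<forall>\<^sub>F n in sequentially. f m n \<le> f i0 n)"
    using insert.prems m by blast
  then show ?case
  proof
    assume "\<forall>\<^sub>F n in sequentially. f m n \<le> f i0 n"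
    then have "\<forall>\<^sub>F n in sequentially. f i n \<le> f i0 n" if "i \<in> I" for i
      using m(2)[OF that] by eventually_elim linarith
    then show ?thesis by (intro bexI[of _ i0]) auto
  qed (use m in auto)
qed

text \<open>
  Distinct polynomials without constant term drift apart at least linearly. Applied to logarithms of
  superpowers, this compares their sizes; applied to the exponents of a prime in them, their valuations.
\<close>

lemma superpower_trichotomy:
  fixes a b :: "nat \<Rightarrow> real"
  obtains (equal) "\<forall>j\<in>{1..l}. a j = b j"
  | (less) \<epsilon> where "\<epsilon> > 0"
      "\<forall>\<^sub>F n in sequentially. (\<Sum>j=1..l. a j * real n ^ j) + \<epsilon> * real n \<le> (\<Sum>j=1..l. b j * real n ^ j)"
  | (greater) \<epsilon> where "\<epsilon> > 0"
      "\<forall>\<^sub>F n in sequentially. (\<Sum>j=1..l. b j * real n ^ j) + \<epsilon> * real n \<le> (\<Sum>j=1..l. a j * real n ^ j)"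
proof (cases "\<forall>j\<in>{1..l}. a j = b j")
  case False
  then have "\<exists>j\<in>{1..l}. a j - b j \<noteq> 0" by auto
  then obtain \<epsilon> where \<epsilon>: "\<epsilon> > 0"
    "(\<forall>\<^sub>F n in sequentially. (\<Sum>j=1..l. (a j - b j) * real n ^ j) \<ge> \<epsilon> * real n) \<or>
     (\<forall>\<^sub>F n in sequentially. (\<Sum>j=1..l. (a j - b j) * real n ^ j) \<le> - \<epsilon> * real n)"
    by (rule polynomial_at_least_linear[where a = "\<lambda>j. a j - b j"])
  have "(\<Sum>j=1..l. (a j - b j) * real n ^ j) = (\<Sum>j=1..l. a j * real n ^ j) - (\<Sum>j=1..l. b j * real n ^ j)" for n
    by (simp add: left_diff_distrib sum_subtractf)
  note \<epsilon>(2)[unfolded this]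
  then show ?thesis
  proof
    assume "\<forall>\<^sub>F n in sequentially. (\<Sum>j=1..l. a j * real n ^ j) - (\<Sum>j=1..l. b j * real n ^ j) \<ge> \<epsilon> * real n"
    then show ?thesis using greater[OF \<epsilon>(1)] by (simp add: algebra_simps)
  next
    assume "\<forall>\<^sub>F n in sequentially. (\<Sum>j=1..l. a j * real n ^ j) - (\<Sum>j=1..l. b j * real n ^ j) \<le> - \<epsilon> * real n"
    then have "\<forall>\<^sub>F n in sequentially. (\<Sum>j=1..l. a j * real n ^ j) + \<epsilon> * real n \<le> (\<Sum>j=1..l. b j * real n ^ j)"
      by eventually_elim simp
    then show ?thesis using less[OF \<epsilon>(1)] by blast
  qed
qed blast

section \<open>The dominant term of a sum of superpowers\<close>

text \<open>
  The exponent of index \<open>0\<close> is left out: its factor does not depend on \<open>n\<close> and belongs to the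
  coefficients, so that the logarithm becomes a polynomial without constant term.
\<close>

definition superpower :: "nat \<Rightarrow> (nat \<Rightarrow> nat) \<Rightarrow> nat \<Rightarrow> nat" where
  "superpower l w n = (\<Prod>j=1..l. w j ^ (n ^ j))"

lemma superpower_pos: "(\<And>j. j \<in> {1..l} \<Longrightarrow> w j > 0) \<Longrightarrow> superpower l w n > 0"
  by (auto simp: superpower_def intro!: prod_pos)

lemma superpower_eq_exp:
  assumes "\<And>j. j \<in> {1..l} \<Longrightarrow> w j > 0"
  shows "real (superpower l w n) = exp (\<Sum>j=1..l. ln (real (w j)) * real n ^ j)"
proof -
  have "exp (ln (real (w j)) * real n ^ j) = real (w j) ^ (n ^ j)" if "j \<in> {1..l}" for j
    using assms[OF that] by (simp add: exp_of_nat2_mult flip: of_nat_power)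
  then show ?thesis by (simp add: superpower_def exp_sum)
qed

text \<open>
  The archimedean estimate uses this with logarithms of the bases, the \<open>p\<close>-adic one with negated
  multiplicities of \<open>p\<close>, for which the greatest polynomial belongs to a term of least valuation.
\<close>

lemma dominant_exponent:
  fixes a :: "'i \<Rightarrow> nat \<Rightarrow> real"
  assumes fin: "finite I" "I \<noteq> {}"
  obtains m where "m \<in> I"
    "\<And>i. i \<in> I \<Longrightarrow> (\<forall>j\<in>{1..l}. a i j = a m j) \<or>
       (\<exists>\<epsilon>>0. \<forall>\<^sub>F n in sequentially.
          (\<Sum>j=1..l. a i j * real n ^ j) + \<epsilon> * real n \<le> (\<Sum>j=1..l. a m j * real n ^ j))"
proof -
  define L where "L i n = (\<Sum>j=1..l. a i j * real n ^ j)" for i n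
  have le: "\<forall>\<^sub>F n in sequentially. L i n \<le> L i' n"
    if "\<epsilon> > 0" "\<forall>\<^sub>F n in sequentially. L i n + \<epsilon> * real n \<le> L i' n" for \<epsilon> i i'
    using that(2)
  proof eventually_elim
    case (elim n)
    moreover have "0 \<le> \<epsilon> * real n" using that(1) by simp
    ultimately show ?case by linarith
  qed
  have "\<exists>m\<in>I. \<forall>i\<in>I. \<forall>\<^sub>F n in sequentially. L i n \<le> L m n"
  proof (rule eventually_greatest_exists[OF fin])
    fix i i'
    show "(\<forall>\<^sub>F n in sequentially. L i n \<le> L i' n) \<or> (\<forall>\<^sub>F n in sequentially. L i' n \<le> L i n)"
    proof (cases rule: superpower_trichotomy[of l "a i" "a i'"])
      case equal
      then show ?thesis by (simp add: L_def)
    qed (use le in \<open>unfold L_def, blast\<close>)+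
  qed
  then obtain m where m: "m \<in> I" "\<And>i. i \<in> I \<Longrightarrow> \<forall>\<^sub>F n in sequentially. L i n \<le> L m n" by blast
  have "(\<forall>j\<in>{1..l}. a i j = a m j) \<or> (\<exists>\<epsilon>>0. \<forall>\<^sub>F n in sequentially. L i n + \<epsilon> * real n \<le> L m n)"
    if i: "i \<in> I" for i
  proof (cases rule: superpower_trichotomy[of l "a i" "a m"])
    case (greater \<epsilon>)
    have "\<forall>\<^sub>F n::nat in sequentially. n > 0" by (rule eventually_gt_at_top)
    then have "\<forall>\<^sub>F n::nat in sequentially. False" using greater(2) m(2)[OF i]
    proof eventually_elim
      case (elim n)
      then have "\<epsilon> * real n \<le> 0" unfolding L_def by linarith
      then show ?case using elim greater(1) by (simp add: mult_le_0_iff)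
    qed
    then show ?thesis by simp
  qed (unfold L_def, blast+)
  then show ?thesis using that m(1) unfolding L_def by blast
qed

text \<open>
  The logarithms of the terms are different polynomials in \<open>n\<close>, so all terms but the greatest are smaller
  by an exponential factor, and their sum cannot cancel more than half of it. In particular the sum is
  eventually non-zero, which the \<open>p\<close>-adic estimate will use for a subfamily.
\<close>

lemma dominant_term:
  fixes c :: "'i \<Rightarrow> int" and w :: "'i \<Rightarrow> nat \<Rightarrow> nat"
  assumes fin: "finite I" "I \<noteq> {}"
    and pos: "\<And>i j. i \<in> I \<Longrightarrow> j \<in> {1..l} \<Longrightarrow> w i j > 0"
    and c: "\<And>i. i \<in> I \<Longrightarrow> c i \<noteq> 0"
    and dist: "\<And>i i'. i \<in> I \<Longrightarrow> i' \<in> I \<Longrightarrow> i \<noteq> i' \<Longrightarrow> \<exists>j\<in>{1..l}. w i j \<noteq> w i' j"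
  obtains m \<epsilon> where "m \<in> I" "\<epsilon> > 0"
    "\<forall>i\<in>I - {m}. \<forall>\<^sub>F n in sequentially.
      exp (\<epsilon> * real n) * real (superpower l (w i) n) \<le> real (superpower l (w m) n)"
    "\<forall>\<^sub>F n in sequentially.
      real (superpower l (w m) n) \<le> 2 * real_of_int \<bar>\<Sum>i\<in>I. c i * int (superpower l (w i) n)\<bar>"
proof -
  define L where "L i n = (\<Sum>j=1..l. ln (real (w i j)) * real n ^ j)" for i n
  have T: "real (superpower l (w i) n) = exp (L i n)" if "i \<in> I" for i n
    unfolding L_def by (rule superpower_eq_exp) (use pos that in auto)
  obtain m where m: "m \<in> I"
    and cmp: "\<And>i. i \<in> I \<Longrightarrow> (\<forall>j\<in>{1..l}. ln (real (w i j)) = ln (real (w m j))) \<or>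
      (\<exists>\<epsilon>>0. \<forall>\<^sub>F n in sequentially. L i n + \<epsilon> * real n \<le> L m n)"
    unfolding L_def by (rule dominant_exponent[OF fin, where l = l and a = "\<lambda>i j. ln (real (w i j))"]) blast
  have "\<exists>\<epsilon>>0. \<forall>\<^sub>F n in sequentially. L i n + \<epsilon> * real n \<le> L m n" if i: "i \<in> I - {m}" for i
  proof -
    obtain j where j: "j \<in> {1..l}" "w i j \<noteq> w m j" using dist[of i m] i m by blast
    then have "ln (real (w i j)) \<noteq> ln (real (w m j))"
      using pos[of i j] pos[of m j] i m by simp
    then show ?thesis using cmp[of i] i j(1) by blast
  qed
  then obtain e where e: "\<And>i. i \<in> I - {m} \<Longrightarrow> e i > 0"
    "\<And>i. i \<in> I - {m} \<Longrightarrow> \<forall>\<^sub>F n in sequentially. L i n + e i * real n \<le> L m n" by metis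
  define \<epsilon> where "\<epsilon> = Min (insert 1 (e ` (I - {m})))"
  have \<epsilon>: "\<epsilon> > 0" "\<And>i. i \<in> I - {m} \<Longrightarrow> \<epsilon> \<le> e i"
    using fin e(1) by (auto simp: \<epsilon>_def)
  have gap: "\<forall>\<^sub>F n in sequentially.
      exp (\<epsilon> * real n) * real (superpower l (w i) n) \<le> real (superpower l (w m) n)"
    if i: "i \<in> I - {m}" for i
    using e(2)[OF i]
  proof eventually_elim
    case (elim n)
    have "\<epsilon> * real n \<le> e i * real n" using \<epsilon>(2)[OF i] by (rule mult_right_mono) simp
    then have "\<epsilon> * real n + L i n \<le> L m n" using elim by linarith
    then show ?case using T i m by (simp flip: exp_add)
  qed
  have small: "\<forall>\<^sub>F n in sequentially. 2 * (\<Sum>i\<in>I-{m}. real_of_int \<bar>c i\<bar> * exp (- \<epsilon> * real n)) \<le> 1"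
  proof -
    have "(\<lambda>n. exp (- \<epsilon> * real n)) \<longlonglongrightarrow> 0" using \<epsilon>(1) by real_asymp
    then have "(\<lambda>n. 2 * (\<Sum>i\<in>I-{m}. real_of_int \<bar>c i\<bar> * exp (- \<epsilon> * real n))) \<longlonglongrightarrow>
        2 * (\<Sum>i\<in>I-{m}. real_of_int \<bar>c i\<bar> * 0)"
      by (intro tendsto_intros)
    then have "\<forall>\<^sub>F n in sequentially. 2 * (\<Sum>i\<in>I-{m}. real_of_int \<bar>c i\<bar> * exp (- \<epsilon> * real n)) < 1"
      by (rule order_tendstoD(2)) simp
    then show ?thesis by eventually_elim simp
  qed
  have "\<forall>\<^sub>F n in sequentially. \<forall>i\<in>I - {m}.
      exp (\<epsilon> * real n) * real (superpower l (w i) n) \<le> real (superpower l (w m) n)"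
    using fin gap by (intro eventually_ball_finite) auto
  then have "\<forall>\<^sub>F n in sequentially.
      real (superpower l (w m) n) \<le> 2 * real_of_int \<bar>\<Sum>i\<in>I. c i * int (superpower l (w i) n)\<bar>"
    using small
  proof eventually_elim
    case (elim n)
    let ?T = "\<lambda>i. real (superpower l (w i) n)"
    have le: "?T i \<le> exp (- \<epsilon> * real n) * ?T m" if "i \<in> I - {m}" for i
      using elim that by (auto simp: exp_minus field_simps)
    have "\<bar>\<Sum>i\<in>I-{m}. real_of_int (c i) * ?T i\<bar> \<le> (\<Sum>i\<in>I-{m}. \<bar>real_of_int (c i) * ?T i\<bar>)"
      by (rule sum_abs)
    also have "\<dots> \<le> (\<Sum>i\<in>I-{m}. real_of_int \<bar>c i\<bar> * (exp (- \<epsilon> * real n) * ?T m))"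
      by (intro sum_mono) (use le in \<open>auto simp: abs_mult intro!: mult_left_mono\<close>)
    also have "\<dots> = (\<Sum>i\<in>I-{m}. real_of_int \<bar>c i\<bar> * exp (- \<epsilon> * real n)) * ?T m"
      by (simp add: sum_distrib_right mult.assoc)
    also have "\<dots> \<le> 1 / 2 * ?T m"
      using elim(2) by (intro mult_right_mono) auto
    finally have rest: "\<bar>\<Sum>i\<in>I-{m}. real_of_int (c i) * ?T i\<bar> \<le> ?T m / 2" by simp
    have "1 \<le> \<bar>real_of_int (c m)\<bar>" using c[OF m] by linarith
    then have "?T m \<le> \<bar>real_of_int (c m) * ?T m\<bar>"
      using mult_right_mono[of 1 "\<bar>real_of_int (c m)\<bar>" "?T m"] by (simp add: abs_mult)
    moreover have "(\<Sum>i\<in>I. real_of_int (c i) * ?T i) = real_of_int (c m) * ?T m + (\<Sum>i\<in>I-{m}. real_of_int (c i) * ?T i)"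
      using m fin by (simp add: sum.remove)
    ultimately have "?T m \<le> 2 * \<bar>\<Sum>i\<in>I. real_of_int (c i) * ?T i\<bar>" using rest by linarith
    then show ?case by simp
  qed
  then show ?thesis using that m \<epsilon>(1) gap by blast
qed

section \<open>Size of the sum against the gcd of its terms\<close>

lemma power_cong_totient:
  fixes a m :: nat
  assumes "coprime a m" "[e = e'] (mod totient m)"
  shows "[a ^ e = a ^ e'] (mod m)"
proof -
  have "ord m a dvd totient m" using assms(1) by (intro order_divides_totient) (simp add: coprime_commute)
  then have "[e = e'] (mod ord m a)" using assms(2) cong_dvd_modulus_nat by blast
  then show ?thesis using order_divides_expdiff[of m a e e'] assms(1) by (simp add: coprime_commute)
qed

text \<open>
  The congruence \<open>n \<equiv> n'\<close> modulo \<open>\<phi>(m)\<close> passes to the powers \<open>n^j\<close>, and Euler's theorem applies to each base.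
\<close>

lemma superpower_cong:
  assumes "\<And>j. j \<in> {1..l} \<Longrightarrow> coprime (w j) m" "[n = n'] (mod totient m)"
  shows "[superpower l w n = superpower l w n'] (mod m)"
  unfolding superpower_def
  by (intro cong_prod power_cong_totient cong_pow assms)

text \<open>
  Integral data of a parity class with at least two collected terms; \<open>total\<close> and \<open>content\<close> are the \<open>S\<close>
  and \<open>g\<close> of the introduction.
\<close>

locale superpower_family =
  fixes l :: nat and I :: "'i set" and w :: "'i \<Rightarrow> nat \<Rightarrow> nat" and c :: "'i \<Rightarrow> int"
  assumes finite_I: "finite I"
    and two_terms: "card I \<ge> 2"
    and w_pos: "i \<in> I \<Longrightarrow> j \<in> {1..l} \<Longrightarrow> w i j > 0"
    and c_nonzero: "i \<in> I \<Longrightarrow> c i \<noteq> 0"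
    and separated: "i \<in> I \<Longrightarrow> i' \<in> I \<Longrightarrow> i \<noteq> i' \<Longrightarrow> \<exists>j\<in>{1..l}. w i j \<noteq> w i' j"
begin

definition total :: "nat \<Rightarrow> int" where
  "total n = (\<Sum>i\<in>I. c i * int (superpower l (w i) n))"

definition content :: "nat \<Rightarrow> nat" where
  "content n = (GCD i\<in>I. superpower l (w i) n)"

lemma I_nonempty: "I \<noteq> {}"
  using two_terms by auto

lemma content_dvd: "i \<in> I \<Longrightarrow> content n dvd superpower l (w i) n"
  unfolding content_def by (rule Gcd_dvd) auto

lemma superpower_w_pos: "i \<in> I \<Longrightarrow> superpower l (w i) n > 0"
  by (rule superpower_pos) (use w_pos in auto)

lemma content_pos: "content n > 0"
  using I_nonempty content_dvd superpower_w_pos by (metis dvd_0_left_iff ex_in_conv gr0I less_numeral_extra(3))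

text \<open>
  The gcd divides a term that is not dominant, which is exponentially smaller than the sum. This needs
  a second term: for a single one the quotient is just the coefficient.
\<close>

lemma sum_outgrows_gcd: "\<forall>\<^sub>F n in sequentially. n * content n \<le> nat \<bar>total n\<bar>"
proof -
  obtain m \<epsilon> where m: "m \<in> I" "\<epsilon> > 0"
    and gap: "\<forall>i\<in>I - {m}. \<forall>\<^sub>F n in sequentially.
      exp (\<epsilon> * real n) * real (superpower l (w i) n) \<le> real (superpower l (w m) n)"
    and dom: "\<forall>\<^sub>F n in sequentially. real (superpower l (w m) n) \<le> 2 * real_of_int \<bar>total n\<bar>"
    unfolding total_def by (rule dominant_term[OF finite_I I_nonempty w_pos c_nonzero separated]) blast
  obtain i where i: "i \<in> I - {m}"
  proof -
    have "card (I - {m}) \<noteq> 0" using two_terms m(1) finite_I by simp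
    then show ?thesis using that by (metis card.empty ex_in_conv)
  qed
  have "\<forall>\<^sub>F n in sequentially. 2 * real n \<le> exp (\<epsilon> * real n)"
    using m(2) by real_asymp
  then show ?thesis using bspec[OF gap i] dom
  proof eventually_elim
    case (elim n)
    have "content n \<le> superpower l (w i) n" using i content_dvd superpower_w_pos by (intro dvd_imp_le) auto
    then have "2 * real n * real (content n) \<le> exp (\<epsilon> * real n) * real (superpower l (w i) n)"
      using elim(1) by (intro mult_mono) auto
    then have "real n * real (content n) \<le> real_of_int \<bar>total n\<bar>" using elim by linarith
    then have "real (n * content n) \<le> real (nat \<bar>total n\<bar>)" by simp
    then show ?case using of_nat_le_iff by blast
  qed
qed

section \<open>Multiplicity of a fixed prime along a progression\<close>

text \<open>
  Let \<open>V\<^sub>m(n)\<close> be the least multiplicity of \<open>p\<close> in a term and \<open>G\<close> the set of terms that have it for all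
  \<open>n\<close>. Then \<open>total n = p^V\<^sub>m(n) (U(n) + R(n))\<close>, where \<open>U\<close> collects the terms in \<open>G\<close> and has bases prime to
  \<open>p\<close>, whereas the multiplicity of \<open>p\<close> in \<open>R(n)\<close> tends to infinity. If \<open>U(n\<^sub>0)\<close> is not zero, it is not
  divisible by some \<open>p^B\<close>, and this persists for all large \<open>n \<equiv> n\<^sub>0\<close> modulo \<open>\<phi>(p^B)\<close>. Since \<open>p^V\<^sub>m(n)\<close> divides
  every term, it divides the gcd.
\<close>

lemma multiplicity_in_progression:
  assumes p: "prime p"
  shows "\<forall>\<^sub>F n0 in sequentially. \<exists>B. \<forall>\<^sub>F n in sequentially.
    [n = n0] (mod totient (p ^ B)) \<longrightarrow>
      multiplicity p (nat \<bar>total n\<bar>) \<le> multiplicity p (content n) + B"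
proof -
  define v where "v i j = multiplicity p (w i j)" for i j
  define V where "V i n = (\<Sum>j=1..l. v i j * n ^ j)" for i n
  define u where "u i j = w i j div p ^ v i j" for i j
  have wu: "w i j = p ^ v i j * u i j" for i j
    unfolding u_def v_def by (simp add: multiplicity_dvd)
  have u_coprime: "coprime (u i j) (p ^ B)" and u_pos: "u i j > 0" if "i \<in> I" "j \<in> {1..l}" for i j B
  proof -
    have "w i j \<noteq> 0" using w_pos[OF that] by simp
    then have "\<not> p dvd u i j"
      unfolding u_def v_def by (intro multiplicity_decompose) (use p in auto)
    then show "coprime (u i j) (p ^ B)"
      using p by (simp add: coprime_commute prime_imp_coprime)
    show "u i j > 0" using wu[of i j] \<open>w i j \<noteq> 0\<close> by (cases "u i j") auto
  qed
  have factor: "superpower l (w i) n = p ^ V i n * superpower l (u i) n" for i n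
    unfolding superpower_def V_def
    by (subst wu) (simp add: power_mult_distrib prod.distrib power_sum flip: power_mult)
  have V_real: "real (V i n) = - (\<Sum>j=1..l. - real (v i j) * real n ^ j)" for i n
    by (simp add: V_def sum_negf)
  obtain m where m: "m \<in> I"
    and cmp: "\<And>i. i \<in> I \<Longrightarrow> (\<forall>j\<in>{1..l}. - real (v i j) = - real (v m j)) \<or>
      (\<exists>\<epsilon>>0. \<forall>\<^sub>F n in sequentially. - real (V i n) + \<epsilon> * real n \<le> - real (V m n))"
    unfolding V_real minus_minus
    by (rule dominant_exponent[OF finite_I I_nonempty, where l = l and a = "\<lambda>i j. - real (v i j)"]) blast
  define G where "G = {i\<in>I. \<forall>j\<in>{1..l}. v i j = v m j}"
  have V_G: "V i n = V m n" if "i \<in> G" for i n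
    using that unfolding V_def G_def by (intro sum.cong) auto
  have V_rest: "\<forall>\<^sub>F n in sequentially. V m n + B \<le> V i n" if i: "i \<in> I - G" for i B
  proof -
    obtain \<epsilon> where \<epsilon>: "\<epsilon> > 0"
      "\<forall>\<^sub>F n in sequentially. - real (V i n) + \<epsilon> * real n \<le> - real (V m n)"
      using cmp[of i] i unfolding G_def by auto
    have "\<forall>\<^sub>F n in sequentially. real B \<le> \<epsilon> * real n" using \<epsilon>(1) by real_asymp
    then show ?thesis using \<epsilon>(2) by eventually_elim linarith
  qed
  define U where "U n = (\<Sum>i\<in>G. c i * int (superpower l (u i) n))" for n
  have G: "finite G" "G \<noteq> {}" "G \<subseteq> I" using finite_I m by (auto simp: G_def)
  have "\<forall>\<^sub>F n in sequentially. U n \<noteq> 0"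
  proof -
    have sep: "\<exists>j\<in>{1..l}. u i j \<noteq> u i' j" if "i \<in> G" "i' \<in> G" "i \<noteq> i'" for i i'
    proof -
      have "i \<in> I" "i' \<in> I" using that G(3) by auto
      then obtain j where j: "j \<in> {1..l}" "w i j \<noteq> w i' j" using separated \<open>i \<noteq> i'\<close> by blast
      moreover have "v i j = v i' j" using that j(1) by (simp add: G_def)
      ultimately show ?thesis using wu[of i j] wu[of i' j] by metis
    qed
    have pos: "u i j > 0" if "i \<in> G" "j \<in> {1..l}" for i j using that u_pos subsetD[OF G(3)] by auto
    have nz: "c i \<noteq> 0" if "i \<in> G" for i using that c_nonzero subsetD[OF G(3)] by auto
    obtain i where i: "i \<in> G"
      and dom: "\<forall>\<^sub>F n in sequentially. real (superpower l (u i) n) \<le> 2 * real_of_int \<bar>U n\<bar>"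
      unfolding U_def by (rule dominant_term[OF G(1,2) pos nz sep]) blast
    from dom show ?thesis
    proof eventually_elim
      case (elim n)
      have "superpower l (u i) n > 0" by (rule superpower_pos) (use pos i in auto)
      then show ?case using elim by auto
    qed
  qed
  then show ?thesis
  proof eventually_elim
    case (elim n0)
    \<comment> \<open>only finitely many powers of \<open>p\<close> divide the non-zero integer \<open>U n0\<close>\<close>
    obtain B where B: "\<not> int p ^ B dvd U n0"
    proof -
      have "finite {n. int p ^ n dvd U n0}"
        using elim p by (intro finite_divisor_powers) (auto simp: prime_gt_1_nat)
      then show ?thesis using that infinite_UNIV_nat by (metis (mono_tags, lifting) UNIV_eq_I mem_Collect_eq)
    qed
    have "\<forall>\<^sub>F n in sequentially. \<forall>i\<in>I - G. V m n + B \<le> V i n"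
      using V_rest finite_I by (intro eventually_ball_finite) auto
    then have "\<forall>\<^sub>F n in sequentially. [n = n0] (mod totient (p ^ B)) \<longrightarrow>
      multiplicity p (nat \<bar>total n\<bar>) \<le> multiplicity p (content n) + B"
    proof eventually_elim
      case (elim n)
      show ?case
      proof
        assume n: "[n = n0] (mod totient (p ^ B))"
        have "[U n = U n0] (mod int p ^ B)"
          unfolding U_def
        proof (intro cong_sum cong_mult cong_refl)
          fix i assume "i \<in> G"
          then have "[superpower l (u i) n = superpower l (u i) n0] (mod p ^ B)"
            using n u_coprime subsetD[OF G(3)] by (intro superpower_cong) auto
          then show "[int (superpower l (u i) n) = int (superpower l (u i) n0)] (mod int p ^ B)"
            by (simp add: cong_int_iff flip: of_nat_power)
        qed
        then have nU: "\<not> int p ^ B dvd U n" using B cong_dvd_iff by blast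
        have "total n = (\<Sum>i\<in>G. c i * int (superpower l (w i) n)) + (\<Sum>i\<in>I-G. c i * int (superpower l (w i) n))"
          unfolding total_def using finite_I G(3) by (simp add: sum.subset_diff add.commute)
        moreover have "(\<Sum>i\<in>G. c i * int (superpower l (w i) n)) = int p ^ V m n * U n"
          unfolding U_def sum_distrib_left
          by (intro sum.cong) (auto simp: factor V_G)
        moreover have "int p ^ V m n * int p ^ B dvd (\<Sum>i\<in>I-G. c i * int (superpower l (w i) n))"
        proof (intro dvd_sum dvd_mult)
          fix i assume "i \<in> I - G"
          then have "int p ^ (V m n + B) dvd int p ^ V i n" using elim by (intro le_imp_power_dvd) auto
          then show "int p ^ V m n * int p ^ B dvd int (superpower l (w i) n)"
            by (simp add: factor power_add)
        qed
        ultimately have "int p ^ V m n * int p ^ B dvd total n \<longleftrightarrow> int p ^ V m n * int p ^ B dvd int p ^ V m n * U n"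
          by (simp add: dvd_add_left_iff)
        also have "\<dots> \<longleftrightarrow> int p ^ B dvd U n" using p by auto
        finally have "\<not> int (p ^ (V m n + B)) dvd total n" using nU by (simp add: power_add)
        then have "\<not> p ^ (V m n + B) dvd nat \<bar>total n\<bar>"
          by (metis int_dvd_int_iff dvd_abs_iff abs_ge_zero nat_0_le)
        then have "multiplicity p (nat \<bar>total n\<bar>) \<le> V m n + B"
          using multiplicity_dvd' nat_le_linear by blast
        moreover have "p ^ V m n dvd content n"
          unfolding content_def
        proof (rule Gcd_greatest)
          fix t assume "t \<in> (\<lambda>i. superpower l (w i) n) ` I"
          then obtain i where i: "i \<in> I" "t = superpower l (w i) n" by auto
          have "V m n \<le> V i n" 
          proof (cases "i \<in> G")
            case False
            then have "V m n + B \<le> V i n" using elim i(1) by blast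
            then show ?thesis by linarith
          qed (use V_G in simp)
          then show "p ^ V m n dvd t" by (simp add: i factor le_imp_power_dvd)
        qed
        then have "V m n \<le> multiplicity p (content n)"
          using p content_pos[of n] by (intro multiplicity_geI) (auto simp: prime_gt_1_nat)
        ultimately show "multiplicity p (nat \<bar>total n\<bar>) \<le> multiplicity p (content n) + B" by linarith
      qed
    qed
    then show ?case by blast
  qed
qed

end

section \<open>The part of a number outside a set of primes\<close>

definition part_outside :: "nat set \<Rightarrow> nat \<Rightarrow> nat" where
  "part_outside P n = (\<Prod>q\<in>prime_factors n - P. q ^ multiplicity q n)"

lemma multiplicity_part_outside:
  assumes "prime q"
  shows "multiplicity q (part_outside P n) = (if q \<in> P then 0 else multiplicity q n)"
proof -
  have "multiplicity q (part_outside P n) = (if q \<in> prime_factors n - P then multiplicity q n else 0)"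
    unfolding part_outside_def by (rule multiplicity_prod_prime_powers) (use assms in auto)
  moreover have "q \<in> prime_factors n \<longleftrightarrow> multiplicity q n > 0"
    using assms prime_factors_multiplicity[of n] by simp
  ultimately show ?thesis by auto
qed

lemma part_outside_pos: "part_outside P n > 0"
  unfolding part_outside_def by (intro prod_pos) (auto simp: in_prime_factors_imp_prime prime_gt_0_nat)

lemma part_outside_decompose:
  assumes "n > 0" "finite P" "\<And>p. p \<in> P \<Longrightarrow> prime p"
  shows "n = part_outside P n * (\<Prod>p\<in>P. p ^ multiplicity p n)"
proof -
  have "n = (\<Prod>p\<in>prime_factors n. p ^ multiplicity p n)"
    using assms(1) by (rule prime_factorization_nat)
  also have "prime_factors n = (prime_factors n - P) \<union> (prime_factors n \<inter> P)" by blast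
  also have "(\<Prod>p\<in>\<dots>. p ^ multiplicity p n) = part_outside P n * (\<Prod>p\<in>prime_factors n \<inter> P. p ^ multiplicity p n)"
    unfolding part_outside_def by (intro prod.union_disjoint) auto
  also have "(\<Prod>p\<in>prime_factors n \<inter> P. p ^ multiplicity p n) = (\<Prod>p\<in>P. p ^ multiplicity p n)"
    using assms by (intro prod.mono_neutral_left) (auto simp: prime_factors_multiplicity)
  finally show ?thesis .
qed

lemma part_outside_coprime:
  assumes "\<And>p. prime p \<Longrightarrow> p dvd a \<Longrightarrow> p \<in> P"
  shows "coprime a (part_outside P n)"
proof (rule ccontr)
  assume "\<not> coprime a (part_outside P n)"
  then have "gcd a (part_outside P n) \<noteq> 1" using coprime_iff_gcd_eq_1 by blast
  from prime_factor_nat[OF this] obtain p where p: "prime p" "p dvd a" "p dvd part_outside P n"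
    by auto
  then have "p \<in> P" using assms by blast
  then have "multiplicity p (part_outside P n) = 0" using multiplicity_part_outside[OF p(1)] by simp
  moreover have "multiplicity p (part_outside P n) \<ge> 1"
    by (rule multiplicity_geI) (use p part_outside_pos[of P n] in \<open>auto simp: prime_gt_1_nat\<close>)
  ultimately show False by simp
qed

text \<open>
  A prime \<open>q\<close> of \<open>x\<close> outside \<open>P\<close>, of multiplicity \<open>v \<ge> 1\<close>, satisfies \<open>q^(v + 1) dvd (part_outside P x)\<^sup>2\<close>.
  Hence a congruence modulo this square preserves the multiplicity of \<open>q\<close>. The unit \<open>e\<close> allows for the
  passage from integers to absolute values.
\<close>

lemma part_outside_dvd_of_no_new_prime:
  assumes "x > 0" "y > 0"
    and congr: "[int x = e * int y] (mod int ((part_outside P x)\<^sup>2))" "\<bar>e\<bar> = 1"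
    and no_new: "prime_factors y - P \<subseteq> prime_factors x"
  shows "part_outside P y dvd part_outside P x"
proof (rule multiplicity_le_imp_dvd)
  show "part_outside P y \<noteq> 0" using part_outside_pos[of P y] by simp
  fix q :: nat assume q: "prime q"
  show "multiplicity q (part_outside P y) \<le> multiplicity q (part_outside P x)"
  proof (rule ccontr)
    assume less: "\<not> ?thesis"
    define v where "v = multiplicity q (part_outside P x)"
    have y: "q \<notin> P" "multiplicity q y > v"
      using less multiplicity_part_outside[OF q] unfolding v_def by (auto split: if_splits)
    then have "q \<in> prime_factors y - P" using q by (auto simp: prime_factors_multiplicity)
    then have "multiplicity q x > 0" using no_new by (auto simp: prime_factors_multiplicity)
    moreover have vx: "v = multiplicity q x" using y multiplicity_part_outside[OF q] by (simp add: v_def)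
    ultimately have "Suc v \<le> v * 2" by simp
    moreover have "q ^ (v * 2) dvd (part_outside P x)\<^sup>2"
      unfolding power_mult v_def by (intro dvd_power_same multiplicity_dvd)
    ultimately have "q ^ Suc v dvd (part_outside P x)\<^sup>2" using power_le_dvd by blast
    then have "[int x = e * int y] (mod int (q ^ Suc v))"
      using congr(1) cong_dvd_modulus of_nat_dvd_iff by blast
    moreover have "int (q ^ Suc v) dvd e * int y"
      using multiplicity_dvd'[of "Suc v" q y] y by (intro dvd_mult) (simp only: of_nat_dvd_iff Suc_leI)
    ultimately have "int (q ^ Suc v) dvd int x" using cong_dvd_iff by blast
    then have "q ^ Suc v dvd x" by (simp only: of_nat_dvd_iff)
    then have "Suc v \<le> multiplicity q x"
      using q assms(1) by (intro multiplicity_geI) (auto simp: prime_gt_1_nat)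
    then show False using vx by simp
  qed
qed

context superpower_family
begin

section \<open>Gaining one prime\<close>

text \<open>
  The primes in \<open>P\<close> contribute to \<open>total n\<close> at most a constant \<open>K\<close> times the gcd of the terms, whereas \<open>total n\<close>
  exceeds \<open>n\<close> times that gcd. One progression serves all \<open>p \<in> P\<close> because the starting point \<open>n\<^sub>0\<close> in
  \<open>multiplicity_in_progression\<close> can be any large number; the modulus is made even to stay in one parity class.
\<close>

lemma part_outside_large_in_progression:
  assumes P: "finite P" "\<And>p. p \<in> P \<Longrightarrow> prime p" and \<pi>: "\<pi> < 2"
  obtains n0 M K where "M > 0" "even M" "K > 0" "n0 mod 2 = \<pi>"
    "\<forall>\<^sub>F n in sequentially. [n = n0] (mod M) \<longrightarrow>
      total n \<noteq> 0 \<and> n \<le> K * part_outside P (nat \<bar>total n\<bar>)"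
proof -
  have "\<forall>\<^sub>F n0 in sequentially. \<forall>p\<in>P. \<exists>B. \<forall>\<^sub>F n in sequentially.
    [n = n0] (mod totient (p ^ B)) \<longrightarrow> multiplicity p (nat \<bar>total n\<bar>) \<le> multiplicity p (content n) + B"
    using P multiplicity_in_progression by (intro eventually_ball_finite) auto
  then obtain N where N: "\<And>n0. n0 \<ge> N \<Longrightarrow> \<forall>p\<in>P. \<exists>B. \<forall>\<^sub>F n in sequentially.
    [n = n0] (mod totient (p ^ B)) \<longrightarrow> multiplicity p (nat \<bar>total n\<bar>) \<le> multiplicity p (content n) + B"
    unfolding eventually_sequentially by blast
  \<comment> \<open>large enough for all \<open>p \<in> P\<close> at once, and of the prescribed parity\<close>
  define n0 where "n0 = 2 * N + \<pi>"
  have "n0 \<ge> N" by (simp add: n0_def)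
  from bchoice[OF N[OF this]] obtain B where B: "\<And>p. p \<in> P \<Longrightarrow> \<forall>\<^sub>F n in sequentially.
    [n = n0] (mod totient (p ^ B p)) \<longrightarrow> multiplicity p (nat \<bar>total n\<bar>) \<le> multiplicity p (content n) + B p"
    by blast
  define M where "M = 2 * (\<Prod>p\<in>P. totient (p ^ B p))"
  define K where "K = (\<Prod>p\<in>P. p ^ B p)"
  have "M > 0" unfolding M_def using P(2) by (auto intro!: prod_pos simp: prime_gt_0_nat)
  moreover have "even M" by (simp add: M_def)
  moreover have "K > 0" unfolding K_def using P(2) by (auto intro!: prod_pos simp: prime_gt_0_nat)
  moreover have "n0 mod 2 = \<pi>" using \<pi> by (simp add: n0_def)
  moreover have "\<forall>\<^sub>F n in sequentially. [n = n0] (mod M) \<longrightarrow>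
      total n \<noteq> 0 \<and> n \<le> K * part_outside P (nat \<bar>total n\<bar>)"
  proof -
    have "\<forall>\<^sub>F n in sequentially. \<forall>p\<in>P. [n = n0] (mod totient (p ^ B p)) \<longrightarrow>
      multiplicity p (nat \<bar>total n\<bar>) \<le> multiplicity p (content n) + B p"
      using P(1) B by (intro eventually_ball_finite) auto
    then show ?thesis using sum_outgrows_gcd eventually_gt_at_top[of 0]
    proof eventually_elim
      case (elim n)
      show ?case
      proof
        assume n: "[n = n0] (mod M)"
        let ?s = "nat \<bar>total n\<bar>"
        have s: "?s > 0" using elim(2,3) content_pos[of n] by (cases "?s") auto
        have "multiplicity p ?s \<le> multiplicity p (content n) + B p" if "p \<in> P" for p
        proof -
          have "totient (p ^ B p) dvd M"
            unfolding M_def using P(1) that by (intro dvd_mult dvd_prodI) auto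
          then show ?thesis using elim(1) that n cong_dvd_modulus_nat by blast
        qed
        then have "(\<Prod>p\<in>P. p ^ multiplicity p ?s) \<le> (\<Prod>p\<in>P. p ^ (multiplicity p (content n) + B p))"
          using P(2) by (intro prod_mono) (auto intro!: power_increasing simp: Suc_leI prime_gt_0_nat)
        also have "\<dots> = K * (\<Prod>p\<in>P. p ^ multiplicity p (content n))"
          by (simp add: K_def power_add prod.distrib mult.commute)
        also have "\<dots> \<le> K * content n"
        proof (intro mult_left_mono)
          have "(\<Prod>p\<in>P. p ^ multiplicity p (content n)) dvd content n"
            using part_outside_decompose[OF content_pos P, of n] by (metis dvd_triv_right)
          then show "(\<Prod>p\<in>P. p ^ multiplicity p (content n)) \<le> content n" using content_pos by (rule dvd_imp_le)
        qed auto
        finally have "part_outside P ?s * (\<Prod>p\<in>P. p ^ multiplicity p ?s) \<le> part_outside P ?s * (K * content n)" by simp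
        then have "?s \<le> part_outside P ?s * (K * content n)" using part_outside_decompose[OF s P] by simp
        also have "\<dots> = (K * part_outside P ?s) * content n" by simp
        finally have "n * content n \<le> (K * part_outside P ?s) * content n" using elim(2) by linarith
        then have "n \<le> K * part_outside P ?s" using content_pos[of n] by (simp only: mult_le_cancel2)
        then show "total n \<noteq> 0 \<and> n \<le> K * part_outside P ?s" using s by simp
      qed
    qed
  qed
  ultimately show ?thesis using that by blast
qed

lemma l_pos: "l \<ge> 1"
proof -
  obtain i i' where "i \<in> I" "i' \<in> I" "i \<noteq> i'"
    using two_terms card_le_Suc0_iff_eq[OF finite_I] by (auto simp: numeral_2_eq_2)
  then show ?thesis using separated by fastforce
qed

lemma sum_bounded_by_superpower:
  obtains H where "H > 0" "\<And>n. n \<ge> 1 \<Longrightarrow> nat \<bar>total n\<bar> \<le> H ^ (n ^ l)"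
proof -
  \<comment> \<open>\<open>n^l\<close> is the largest of the exponents, and each coefficient is at most its \<open>n^l\<close>-th power\<close>
  define h where "h i = nat \<bar>c i\<bar> * (\<Prod>j=1..l. w i j)" for i
  have h: "h i \<ge> 1" if "i \<in> I" for i
    using c_nonzero[OF that] w_pos[OF that] by (auto simp: h_def intro!: Suc_leI prod_pos)
  define H where "H = (\<Sum>i\<in>I. h i)"
  have hH: "h i \<le> H" if "i \<in> I" for i
    unfolding H_def using finite_I that by (intro member_le_sum) auto
  show ?thesis
  proof (rule that[of "card I * H"])
    have H1: "H \<ge> 1" using h hH I_nonempty by (meson ex_in_conv order_trans)
    show "card I * H > 0" using H1 two_terms by simp
    fix n :: nat assume n: "n \<ge> 1"
    have "nat \<bar>c i\<bar> * superpower l (w i) n \<le> H ^ (n ^ l)" if i: "i \<in> I" for i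
    proof -
      have "superpower l (w i) n \<le> (\<Prod>j=1..l. w i j ^ (n ^ l))"
        unfolding superpower_def using i w_pos n
        by (intro prod_mono) (auto intro!: power_increasing simp: Suc_leI)
      also have "\<dots> = (\<Prod>j=1..l. w i j) ^ (n ^ l)" by (simp add: prod_power_distrib)
      finally have "nat \<bar>c i\<bar> * superpower l (w i) n \<le> nat \<bar>c i\<bar> ^ (n ^ l) * (\<Prod>j=1..l. w i j) ^ (n ^ l)"
        using c_nonzero[OF i] n by (intro mult_mono self_le_power) auto
      also have "\<dots> = h i ^ (n ^ l)" by (simp add: h_def power_mult_distrib)
      also have "\<dots> \<le> H ^ (n ^ l)" using hH[OF i] by (intro power_mono) auto
      finally show ?thesis .
    qed
    then have "(\<Sum>i\<in>I. nat \<bar>c i\<bar> * superpower l (w i) n) \<le> card I * H ^ (n ^ l)"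
      using sum_bounded_above[of I _ "H ^ (n ^ l)"] by simp
    also have "\<dots> \<le> card I ^ (n ^ l) * H ^ (n ^ l)"
      using n two_terms by (intro mult_right_mono self_le_power) auto
    finally have bound: "(\<Sum>i\<in>I. nat \<bar>c i\<bar> * superpower l (w i) n) \<le> (card I * H) ^ (n ^ l)"
      by (simp add: power_mult_distrib)
    have "\<bar>total n\<bar> \<le> (\<Sum>i\<in>I. \<bar>c i * int (superpower l (w i) n)\<bar>)" unfolding total_def by (rule sum_abs)
    also have "\<dots> = int (\<Sum>i\<in>I. nat \<bar>c i\<bar> * superpower l (w i) n)" by (simp add: abs_mult)
    finally show "nat \<bar>total n\<bar> \<le> (card I * H) ^ (n ^ l)" using bound by linarith
  qed
qed

text \<open>
  With \<open>r\<close> the part of \<open>total n\<close> outside \<open>P\<close>, the next index is \<open>n' = n + K (r + 1) M \<phi>(r\<^sup>2)\<close>. The factor \<open>M\<close> keeps it in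
  the progression, \<open>\<phi>(r\<^sup>2)\<close> keeps \<open>total\<close> fixed modulo \<open>r\<^sup>2\<close>, and \<open>K (r + 1)\<close> makes \<open>n'\<close> exceed \<open>K r\<close>. If no new
  prime appeared, the part \<open>r'\<close> of \<open>total n'\<close> outside \<open>P\<close> would divide \<open>r\<close>, contradicting \<open>n' \<le> K r'\<close>. The
  bound on \<open>n'\<close> comes from \<open>r \<le> \<bar>total n\<bar>\<close>.
\<close>

lemma new_prime_nearby:
  assumes P: "finite P" "\<And>p. p \<in> P \<Longrightarrow> prime p" and \<pi>: "\<pi> < 2"
    and P_w: "\<And>p i j. prime p \<Longrightarrow> i \<in> I \<Longrightarrow> j \<in> {1..l} \<Longrightarrow> p dvd w i j \<Longrightarrow> p \<in> P"
  obtains n0 M N D where "even M" "n0 mod 2 = \<pi>" "M > 0" "D > 0"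
    "\<forall>n\<ge>N. [n = n0] (mod M) \<longrightarrow> total n \<noteq> 0 \<and>
      (\<exists>n'>n. [n' = n0] (mod M) \<and> n' \<le> D ^ (n ^ l) \<and>
        card (prime_factors (nat \<bar>total n\<bar>) - P) < card (prime_factors (nat \<bar>total n'\<bar>) - P))"
proof -
  obtain n0 M K where M: "M > 0" "even M" "K > 0" "n0 mod 2 = \<pi>"
    and ev: "\<forall>\<^sub>F n in sequentially. [n = n0] (mod M) \<longrightarrow>
      total n \<noteq> 0 \<and> n \<le> K * part_outside P (nat \<bar>total n\<bar>)"
    by (rule part_outside_large_in_progression[OF P \<pi>])
  obtain H where H: "H > 0" "\<And>n. n \<ge> 1 \<Longrightarrow> nat \<bar>total n\<bar> \<le> H ^ (n ^ l)"
    by (rule sum_bounded_by_superpower) blast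
  obtain N where N: "\<And>n. n \<ge> N \<Longrightarrow> [n = n0] (mod M) \<Longrightarrow> total n \<noteq> 0 \<and> n \<le> K * part_outside P (nat \<bar>total n\<bar>)"
    using ev unfolding eventually_sequentially by blast
  define D where "D = 4 * K * M * H ^ 3"
  have "D > 0" using M H by (simp add: D_def)
  moreover have "\<forall>n\<ge>max N 1. [n = n0] (mod M) \<longrightarrow> total n \<noteq> 0 \<and>
      (\<exists>n'>n. [n' = n0] (mod M) \<and> n' \<le> D ^ (n ^ l) \<and>
        card (prime_factors (nat \<bar>total n\<bar>) - P) < card (prime_factors (nat \<bar>total n'\<bar>) - P))"
  proof (intro allI impI)
    fix n assume "max N 1 \<le> n" and n: "[n = n0] (mod M)"
    then have nN: "n \<ge> N" "n \<ge> 1" by auto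
    define r where "r = part_outside P (nat \<bar>total n\<bar>)"
    have r: "r > 0" by (simp add: r_def part_outside_pos)
    define n' where "n' = n + K * (r + 1) * M * totient (r\<^sup>2)"
    have "n' > n" using M r by (simp add: n'_def)
    have n': "[n' = n0] (mod M)"
    proof -
      have "n' = n + M * (K * (r + 1) * totient (r\<^sup>2))" by (simp add: n'_def)
      then have "[n' = n] (mod M)" by (simp only: unique_euclidean_semiring_class.cong_def mod_mult_self2)
      then show ?thesis using n by (rule cong_trans)
    qed
    have nonzero: "total n \<noteq> 0" "total n' \<noteq> 0" "n' \<le> K * part_outside P (nat \<bar>total n'\<bar>)"
      using N n n' nN \<open>n' > n\<close> by auto
    have total_cong: "[total n = total n'] (mod int (r\<^sup>2))"
      unfolding total_def
    proof (intro cong_sum cong_mult cong_refl)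
      fix i assume i: "i \<in> I"
      have "[superpower l (w i) n = superpower l (w i) n'] (mod r\<^sup>2)"
      proof (rule superpower_cong)
        fix j assume j: "j \<in> {1..l}"
        have "coprime (w i j) r" unfolding r_def using P_w i j by (intro part_outside_coprime) blast
        then show "coprime (w i j) (r\<^sup>2)" by simp
      next
        show "[n = n'] (mod totient (r\<^sup>2))" by (simp add: n'_def unique_euclidean_semiring_class.cong_def)
      qed
      then show "[int (superpower l (w i) n) = int (superpower l (w i) n')] (mod int (r\<^sup>2))"
        by (simp only: cong_int_iff)
    qed
    have sub: "prime_factors (nat \<bar>total n\<bar>) - P \<subseteq> prime_factors (nat \<bar>total n'\<bar>) - P"
    proof
      fix q assume q: "q \<in> prime_factors (nat \<bar>total n\<bar>) - P"
      then have "prime q" "multiplicity q r > 0"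
        unfolding r_def by (auto simp: multiplicity_part_outside prime_factors_multiplicity)
      then have "q dvd r" by (metis less_irrefl not_dvd_imp_multiplicity_0)
      then have "q dvd r\<^sup>2" by (simp add: power2_eq_square)
      then have "[total n = total n'] (mod int q)" using total_cong cong_dvd_modulus of_nat_dvd_iff by blast
      moreover have "int q dvd total n" using q by (auto simp: in_prime_factors_iff nat_dvd_iff dvd_nat_abs_iff)
      ultimately have "int q dvd total n'" using cong_dvd_iff by blast
      then show "q \<in> prime_factors (nat \<bar>total n'\<bar>) - P"
        using q nonzero by (auto simp: in_prime_factors_iff dvd_nat_abs_iff)
    qed
    have "prime_factors (nat \<bar>total n\<bar>) - P \<noteq> prime_factors (nat \<bar>total n'\<bar>) - P"
    proof
      assume eq: "prime_factors (nat \<bar>total n\<bar>) - P = prime_factors (nat \<bar>total n'\<bar>) - P"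
      have "part_outside P (nat \<bar>total n'\<bar>) dvd part_outside P (nat \<bar>total n\<bar>)"
      proof (rule part_outside_dvd_of_no_new_prime[where e = "sgn (total n) * sgn (total n')"])
        show "[int (nat \<bar>total n\<bar>) = sgn (total n) * sgn (total n') * int (nat \<bar>total n'\<bar>)] (mod int ((part_outside P (nat \<bar>total n\<bar>))\<^sup>2))"
        proof -
          have "sgn (total n) * total n = \<bar>total n\<bar>" "sgn (total n') * \<bar>total n'\<bar> = total n'" by (auto simp: abs_if sgn_if)
          then show ?thesis using cong_mult[OF cong_refl total_cong, of "sgn (total n)"]
            unfolding r_def by (simp add: mult.assoc)
        qed
        show "\<bar>sgn (total n) * sgn (total n')\<bar> = 1" using nonzero by (simp add: abs_mult)
      qed (use nonzero eq in auto)
      then have "part_outside P (nat \<bar>total n'\<bar>) \<le> r" using part_outside_pos unfolding r_def by (intro dvd_imp_le) auto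
      then have "n' \<le> K * r" using nonzero(3) M by (meson le_trans mult_le_mono2)
      also have "K * r < K * (r + 1) * 1 * 1" using M by simp
      also have "\<dots> \<le> K * (r + 1) * M * totient (r\<^sup>2)"
        using M r by (intro mult_mono) (auto simp: Suc_leI)
      also have "\<dots> \<le> n'" unfolding n'_def by (rule le_add2)
      finally show False by simp
    qed
    then have card: "card (prime_factors (nat \<bar>total n\<bar>) - P) < card (prime_factors (nat \<bar>total n'\<bar>) - P)"
      using sub by (intro psubset_card_mono) auto
    have "n' \<le> D ^ (n ^ l)"
    proof -
      let ?m = "n ^ l"
      have m: "?m \<ge> 1" "n \<le> ?m" using nN l_pos by (auto intro: self_le_power)
      have "nat \<bar>total n\<bar> > 0" using nonzero by simp
      then have "r \<le> nat \<bar>total n\<bar>"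
        unfolding r_def using part_outside_decompose[OF _ P] by (metis dvd_imp_le dvd_triv_left)
      then have rH: "r \<le> H ^ ?m" using H(2) nN le_trans by blast
      have "n' \<le> n + K * (r + 1) * M * r\<^sup>2" unfolding n'_def by (simp add: totient_le)
      also have "\<dots> \<le> n + K * (2 * r) * M * r\<^sup>2" using r by (intro add_left_mono mult_mono) auto
      also have "\<dots> = n + 2 * K * M * r ^ 3" by (simp add: power2_eq_square power3_eq_cube)
      also have "\<dots> \<le> n * (2 * K * M * r ^ 3) + 2 * K * M * r ^ 3"
        using M r by simp
      also have "\<dots> = (n + 1) * (2 * K * M * r ^ 3)" by simp
      also have "\<dots> \<le> 2 ^ ?m * (2 * K * M * (H ^ ?m) ^ 3)"
      proof (intro mult_mono power_mono rH)
        have "n + 1 \<le> 2 ^ n" using less_exp[of n] by (simp add: Suc_leI)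
        also have "\<dots> \<le> 2 ^ ?m" using m by (intro power_increasing) auto
        finally show "n + 1 \<le> 2 ^ ?m" .
      qed auto
      also have "\<dots> \<le> 2 ^ ?m * ((2 * K * M) ^ ?m * (H ^ ?m) ^ 3)"
        using m M nN by (intro mult_left_mono mult_right_mono self_le_power) auto
      also have "\<dots> = D ^ ?m"
      proof -
        have "(H ^ ?m) ^ 3 = (H ^ 3) ^ ?m" by (simp only: mult.commute flip: power_mult)
        moreover have "D = 2 * ((2 * K * M) * H ^ 3)" by (simp add: D_def)
        ultimately show ?thesis by (simp only: power_mult_distrib)
      qed
      finally show ?thesis .
    qed
    then show "total n \<noteq> 0 \<and> (\<exists>n'>n. [n' = n0] (mod M) \<and> n' \<le> D ^ (n ^ l) \<and>
        card (prime_factors (nat \<bar>total n\<bar>) - P) < card (prime_factors (nat \<bar>total n'\<bar>) - P))"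
      using nonzero n' card \<open>n' > n\<close> by blast
  qed
  ultimately show ?thesis using that M by blast
qed

end

section \<open>Towers, the super-logarithm and unbounded sequences\<close>

lemma tower_ge_1: "\<theta> > 1 \<Longrightarrow> tower \<theta> \<kappa> \<ge> 1"
  by (induction \<kappa>) (auto intro!: ge_one_powr_ge_zero)

lemma tower_mono:
  assumes "\<theta> > 1" "\<kappa> \<le> \<kappa>'"
  shows "tower \<theta> \<kappa> \<le> tower \<theta> \<kappa>'"
proof -
  have step: "tower \<theta> m \<le> tower \<theta> (Suc m)" for m
  proof (induction m)
    case 0
    show ?case using tower_ge_1[OF assms(1), of 1] by simp
  next
    case (Suc m)
    then show ?case using assms(1) by (auto intro!: powr_mono)
  qed
  show ?thesis using lift_Suc_mono_le[of "tower \<theta>", OF step assms(2)] .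
qed

lemma slog_less:
  assumes "\<theta> > 1" "n \<ge> 1" "real n < tower \<theta> \<kappa>"
  shows "slog \<theta> n < enat \<kappa>"
proof -
  have sub: "{\<kappa>. tower \<theta> \<kappa> \<le> real n} \<subseteq> {..<\<kappa>}"
  proof
    fix m assume "m \<in> {\<kappa>. tower \<theta> \<kappa> \<le> real n}"
    then have "tower \<theta> m < tower \<theta> \<kappa>" using assms(3) by simp
    then show "m \<in> {..<\<kappa>}" using tower_mono[OF assms(1), of \<kappa> m] by (meson lessThan_iff not_le)
  qed
  then have fin: "finite {\<kappa>. tower \<theta> \<kappa> \<le> real n}" using finite_subset by blast
  have "0 \<in> {\<kappa>. tower \<theta> \<kappa> \<le> real n}" using assms(2) by simp
  then have "Max {\<kappa>. tower \<theta> \<kappa> \<le> real n} \<in> {\<kappa>. tower \<theta> \<kappa> \<le> real n}" using fin by (intro Max_in) blast+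
  then have "Max {\<kappa>. tower \<theta> \<kappa> \<le> real n} < \<kappa>" using sub by blast
  then show ?thesis using fin by (simp add: slog_def)
qed

lemma slog_ge:
  assumes "tower \<theta> \<kappa> \<le> real n"
  shows "enat \<kappa> \<le> slog \<theta> n"
  using assms Max_ge[of "{\<kappa>. tower \<theta> \<kappa> \<le> real n}" \<kappa>] by (simp add: slog_def)

lemma limsup_eq_infinity_iff:
  fixes X :: "nat \<Rightarrow> enat"
  shows "limsup X = \<infinity> \<longleftrightarrow> (\<forall>m. \<exists>\<^sub>F n in sequentially. enat m < X n)"
proof
  assume inf: "limsup X = \<infinity>"
  show "\<forall>m. \<exists>\<^sub>F n in sequentially. enat m < X n"
  proof (rule allI, rule ccontr)
    fix m assume "\<not> (\<exists>\<^sub>F n in sequentially. enat m < X n)"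
    then have "\<forall>\<^sub>F n in sequentially. X n \<le> enat m" by (simp add: not_frequently not_less)
    then have "limsup X \<le> enat m" by (rule Limsup_bounded)
    then show False using inf by simp
  qed
next
  assume freq: "\<forall>m. \<exists>\<^sub>F n in sequentially. enat m < X n"
  show "limsup X = \<infinity>"
  proof (rule ccontr)
    assume "limsup X \<noteq> \<infinity>"
    then obtain m where m: "limsup X = enat m" by auto
    then have "\<forall>\<^sub>F n in sequentially. X n < enat (Suc m)"
      using Limsup_le_iff[of sequentially X "enat m"] by simp
    then have "\<forall>\<^sub>F n in sequentially. \<not> enat m < X n"
    proof eventually_elim
      case (elim n)
      then show ?case by (cases "X n") auto
    qed
    then show False using freq by (simp add: frequently_def)
  qed
qed

section \<open>Prime divisors of rational numbers\<close>

text \<open>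
  No prime enters besides those in the numerators and denominators of the bases, whatever the exponents.
\<close>

lemma omega_rat_superpower_bounded:
  fixes a :: "nat \<Rightarrow> rat"
  assumes "\<And>j. j \<le> l \<Longrightarrow> a j \<noteq> 0"
  obtains B where "\<And>e. omega_rat (\<Prod>j=0..l. a j ^ e j) \<le> enat B"
proof -
  define N where "N j = fst (quotient_of (a j))" for j
  define D where "D j = snd (quotient_of (a j))" for j
  have D: "D j > 0" for j unfolding D_def by (rule quotient_of_denom_pos')
  have a: "a j = of_int (N j) / of_int (D j)" for j
    unfolding N_def D_def by (rule quotient_of_div) simp
  have N: "N j \<noteq> 0" if "j \<le> l" for j using assms[OF that] a[of j] by auto
  define A where "A = (\<Union>j\<in>{0..l}. prime_factors (N j) \<union> prime_factors (D j))"
  have A: "finite A" by (simp add: A_def)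
  show ?thesis
  proof (rule that[of "card A + card A"])
    fix e
    let ?s = "\<Prod>j=0..l. a j ^ e j"
    obtain u v where uv: "quotient_of ?s = (u, v)" by fastforce
    have v: "v > 0" using uv quotient_of_denom_pos by blast
    have cop: "coprime u v" using uv quotient_of_coprime by blast
    have "of_int u / of_int v = ?s" using quotient_of_div[OF uv] by simp
    also have "\<dots> = of_int (\<Prod>j=0..l. N j ^ e j) / of_int (\<Prod>j=0..l. D j ^ e j)"
      by (simp add: a power_divide prod_dividef)
    finally have "of_int u * of_int (\<Prod>j=0..l. D j ^ e j) = (of_int (\<Prod>j=0..l. N j ^ e j) * of_int v :: rat)"
    proof (subst (asm) frac_eq_eq)
      have "(\<Prod>j=0..l. D j ^ e j) > 0" using D by (intro prod_pos) auto
      then show "of_int (\<Prod>j=0..l. D j ^ e j) \<noteq> (0 :: rat)" by linarith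
      show "of_int v \<noteq> (0 :: rat)" using v by simp
    qed
    then have eq: "u * (\<Prod>j=0..l. D j ^ e j) = (\<Prod>j=0..l. N j ^ e j) * v"
      by (simp only: flip: of_int_mult)
    have u0: "u \<noteq> 0"
    proof
      assume "u = 0"
      then have "(\<Prod>j=0..l. N j ^ e j) = 0" using eq v by simp
      then show False using N by auto
    qed
    have "prime_factors u \<subseteq> A"
    proof
      fix q assume q: "q \<in> prime_factors u"
      then have "prime q" "q dvd u" by auto
      moreover from this have "\<not> q dvd v" using cop by (meson coprime_common_divisor not_prime_unit)
      moreover have "q dvd (\<Prod>j=0..l. N j ^ e j) * v" using \<open>q dvd u\<close> unfolding eq[symmetric] by (rule dvd_mult2)
      ultimately have "q dvd (\<Prod>j=0..l. N j ^ e j)" using prime_dvd_multD by blast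
      then obtain j where "j \<le> l" "q dvd N j ^ e j" using \<open>prime q\<close> by (auto simp: prime_dvd_prod_iff)
      then have "q dvd N j" using \<open>prime q\<close> prime_dvd_power by blast
      then have "q \<in> prime_factors (N j)" using \<open>prime q\<close> N \<open>j \<le> l\<close> by (intro prime_factorsI) auto
      then show "q \<in> A" using \<open>j \<le> l\<close> by (auto simp: A_def)
    qed
    moreover have "prime_factors v \<subseteq> A"
    proof
      fix q assume q: "q \<in> prime_factors v"
      then have "prime q" "q dvd v" by auto
      moreover from this have "\<not> q dvd u" using cop by (meson coprime_common_divisor not_prime_unit)
      moreover have "q dvd u * (\<Prod>j=0..l. D j ^ e j)" using \<open>q dvd v\<close> unfolding eq by (rule dvd_mult)
      ultimately have "q dvd (\<Prod>j=0..l. D j ^ e j)" using prime_dvd_multD by blast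
      then obtain j where "j \<le> l" "q dvd D j ^ e j" using \<open>prime q\<close> by (auto simp: prime_dvd_prod_iff)
      then have "q dvd D j" using \<open>prime q\<close> prime_dvd_power by blast
      then have "q \<in> prime_factors (D j)" using \<open>prime q\<close> D[of j] by (intro prime_factorsI) auto
      then show "q \<in> A" using \<open>j \<le> l\<close> by (auto simp: A_def)
    qed
    ultimately have "card (prime_factors u) \<le> card A" "card (prime_factors v) \<le> card A"
      using A by (auto intro: card_mono)
    then show "omega_rat ?s \<le> enat (card A + card A)"
      using u0 v by (simp add: omega_rat_def omega_int_def uv)
  qed
qed

text \<open>
  Transfers a prime count back to \<open>r\<close> after denominators have been cleared: a prime of the integer \<open>z\<close>
  that does not divide the multiplier \<open>d\<close> must divide the numerator of \<open>r\<close>.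
\<close>

lemma card_prime_factors_le_omega_rat:
  fixes r :: rat
  assumes eq: "r * of_int d = of_int z" and z: "z \<noteq> 0"
    and P: "\<And>p. prime p \<Longrightarrow> int p dvd d \<Longrightarrow> p \<in> P"
  shows "enat (card (prime_factors (nat \<bar>z\<bar>) - P)) \<le> omega_rat r"
proof -
  obtain u v where uv: "quotient_of r = (u, v)" by fastforce
  have v: "v > 0" using uv quotient_of_denom_pos by blast
  have "of_int u * of_int d = (of_int z * of_int v :: rat)"
    using eq quotient_of_div[OF uv] v by (simp add: field_simps)
  then have uz: "u * d = z * v" by (simp only: flip: of_int_mult)
  then have u0: "u \<noteq> 0" using z v by auto
  have "int ` (prime_factors (nat \<bar>z\<bar>) - P) \<subseteq> prime_factors u"
  proof
    fix q' assume "q' \<in> int ` (prime_factors (nat \<bar>z\<bar>) - P)"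
    then obtain q where q: "q' = int q" "q \<in> prime_factors (nat \<bar>z\<bar>)" "q \<notin> P" by auto
    have pq: "prime q" using q(2) by auto
    have "q dvd nat \<bar>z\<bar>" using q(2) by auto
    then have "int q dvd z" by (simp add: dvd_nat_abs_iff)
    then have "int q dvd u * d" using uz by simp
    moreover have "\<not> int q dvd d" using P pq q(3) by blast
    ultimately have "int q dvd u" using pq by (simp add: prime_dvd_mult_iff)
    then show "q' \<in> prime_factors u" using pq q(1) u0 by (intro prime_factorsI) auto
  qed
  then have "card (int ` (prime_factors (nat \<bar>z\<bar>) - P)) \<le> card (prime_factors u)"
    by (intro card_mono) auto
  then have "card (prime_factors (nat \<bar>z\<bar>) - P) \<le> card (prime_factors u)"
    by (simp add: card_image)
  then have "enat (card (prime_factors (nat \<bar>z\<bar>) - P)) \<le> omega_int u"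
    using u0 by (simp add: omega_int_def)
  also have "\<dots> \<le> omega_rat r" by (simp add: omega_rat_def uv)
  finally show ?thesis .
qed

lemma common_denominator:
  fixes A :: "rat set"
  assumes "finite A"
  obtains d :: nat where "d > 0" "\<And>a. a \<in> A \<Longrightarrow> \<exists>z::int. a * of_nat d = of_int z"
proof -
  have "\<exists>d::nat. d > 0 \<and> (\<forall>a\<in>A. \<exists>z::int. a * of_nat d = of_int z)"
    using assms
  proof (induction A)
    case (insert a A)
    then obtain d :: nat where d: "d > 0" "\<And>a. a \<in> A \<Longrightarrow> \<exists>z::int. a * of_nat d = of_int z" by blast
    obtain u v where uv: "quotient_of a = (u, v)" by fastforce
    have v: "v > 0" using uv quotient_of_denom_pos by blast
    have "b * of_nat (d * nat v) \<in> \<int>" if "b \<in> insert a A" for b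
    proof (cases "b = a")
      case True
      have "b * of_nat (d * nat v) = of_int (u * int d)"
        using True quotient_of_div[OF uv] v by (simp add: of_nat_nat)
      then show ?thesis by (metis Ints_of_int)
    next
      case False
      then have "b \<in> A" using that by simp
      from d(2)[OF this] obtain z :: int where "b * of_nat d = of_int z" ..
      then have "b * of_nat (d * nat v) = of_int (z * v)" using v by (simp add: of_nat_nat flip: mult.assoc)
      then show ?thesis by (metis Ints_of_int)
    qed
    then show ?case using d(1) v by (intro exI[of _ "d * nat v"]) (auto elim!: Ints_cases)
  qed auto
  then show ?thesis using that by blast
qed

context superpower_family
begin

section \<open>Prime divisors at tower speed\<close>

text \<open>
  If \<open>n'\<close> is the index that gains a prime, then \<open>n' \<le> D^(n^l)\<close> gives \<open>n'^l \<le> (D^l)^(n^l)\<close>, so it is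
  \<open>n^l\<close> rather than \<open>n\<close> that climbs by one exponentiation per prime and stays below a tower. The base of the
  tower can be chosen after the start of the iteration, which absorbs all constants.
\<close>

lemma many_primes_at_tower_speed:
  assumes P: "finite P" "\<And>p. p \<in> P \<Longrightarrow> prime p" and \<pi>: "\<pi> < 2"
    and P_w: "\<And>p i j. prime p \<Longrightarrow> i \<in> I \<Longrightarrow> j \<in> {1..l} \<Longrightarrow> p dvd w i j \<Longrightarrow> p \<in> P"
  shows "\<exists>\<theta>>1. infinite {n. n \<ge> 2 \<and> n mod 2 = \<pi> \<and> total n \<noteq> 0 \<and>
    slog \<theta> n < enat (card (prime_factors (nat \<bar>total n\<bar>) - P))}"
proof -
  define Q where "Q n = card (prime_factors (nat \<bar>total n\<bar>) - P)" for n
  obtain n0 M N D where M: "even M" "n0 mod 2 = \<pi>" "M > 0" "D > 0"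
    and step: "\<forall>n\<ge>N. [n = n0] (mod M) \<longrightarrow> total n \<noteq> 0 \<and>
      (\<exists>n'>n. [n' = n0] (mod M) \<and> n' \<le> D ^ (n ^ l) \<and> Q n < Q n')"
    unfolding Q_def by (rule new_prime_nearby[OF P \<pi> P_w]) blast
  \<comment> \<open>One step away from \<open>m\<close> is taken first, so that the iteration starts with a prime outside \<open>P\<close>.\<close>
  define m where "m = n0 + (N + 2) * M"
  have m: "m \<ge> N + 2" using M(3) mult_le_mono2[of 1 M "N + 2"] by (simp add: m_def)
  have m_cong: "[m = n0] (mod M)"
    by (simp only: m_def unique_euclidean_semiring_class.cong_def mod_mult_self1)
  from step m m_cong obtain n1 where n1: "n1 > m" "[n1 = n0] (mod M)" "Q n1 > 0"
    by (metis add_leD1 gr_zeroI not_less_zero)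
  \<comment> \<open>\<open>D ^ l\<close> pays for each step of the iteration, \<open>n1 ^ l\<close> for its start; \<open>+ 1\<close> makes the inequality strict\<close>
  define \<theta> where "\<theta> = real (D ^ l + n1 ^ l) + 1"
  have \<theta>: "\<theta> > 1" using M(4) by (simp add: \<theta>_def add_pos_nonneg)
  have "\<exists>n. n \<ge> N + 2 + \<kappa> \<and> [n = n0] (mod M) \<and> Suc \<kappa> \<le> Q n \<and> real (n ^ l) < tower \<theta> (Suc \<kappa>)" for \<kappa>
  proof (induction \<kappa>)
    case 0
    show ?case using n1 m \<theta> by (intro exI[of _ n1]) (auto simp: \<theta>_def add_nonneg_pos)
  next
    case (Suc \<kappa>)
    then obtain n where n: "n \<ge> N + 2 + \<kappa>" "[n = n0] (mod M)" "Suc \<kappa> \<le> Q n"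
      "real (n ^ l) < tower \<theta> (Suc \<kappa>)" by blast
    have "N \<le> n" using n(1) by simp
    then obtain n' where n': "n' > n" "[n' = n0] (mod M)" "n' \<le> D ^ (n ^ l)" "Q n < Q n'"
      using step n(2) by blast
    have "real (n' ^ l) \<le> real ((D ^ (n ^ l)) ^ l)" using n'(3) by (intro of_nat_mono power_mono) auto
    also have "\<dots> = real (D ^ l) ^ (n ^ l)" by (simp add: mult.commute flip: power_mult)
    also have "\<dots> \<le> \<theta> ^ (n ^ l)" by (intro power_mono) (auto simp: \<theta>_def)
    also have "\<dots> = \<theta> powr real (n ^ l)" using \<theta> powr_realpow[of \<theta> "n ^ l"] by (simp only:)
    also have "\<dots> < \<theta> powr tower \<theta> (Suc \<kappa>)" using \<theta> n(4) by (intro powr_less_mono)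
    finally have "real (n' ^ l) < tower \<theta> (Suc (Suc \<kappa>))" by simp
    then show ?case using n n' by (intro exI[of _ n']) auto
  qed
  then have unbounded: "\<exists>n. n \<ge> N + 2 + \<kappa> \<and> [n = n0] (mod M) \<and> Suc \<kappa> \<le> Q n \<and> real (n ^ l) < tower \<theta> (Suc \<kappa>)" for \<kappa>
    by blast
  have "infinite {n. n \<ge> 2 \<and> n mod 2 = \<pi> \<and> total n \<noteq> 0 \<and> slog \<theta> n < enat (Q n)}"
    unfolding infinite_nat_iff_unbounded_le
  proof
    fix \<kappa>
    obtain n where n: "n \<ge> N + 2 + \<kappa>" "[n = n0] (mod M)" "Suc \<kappa> \<le> Q n" "real (n ^ l) < tower \<theta> (Suc \<kappa>)"
      using unbounded by blast
    have "n \<le> n ^ l" using n(1) l_pos by (intro self_le_power) auto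
    then have "real n < tower \<theta> (Suc \<kappa>)" using n(4) by linarith
    then have "slog \<theta> n < enat (Suc \<kappa>)" using \<theta> n(1) by (intro slog_less) auto
    also have "\<dots> \<le> enat (Q n)" using n(3) by simp
    finally have "slog \<theta> n < enat (Q n)" .
    moreover have "n mod 2 = \<pi>" using n(2) M(1,2) cong_dvd_modulus_nat
      unfolding unique_euclidean_semiring_class.cong_def by blast
    moreover have "total n \<noteq> 0" using step n by auto
    ultimately show "\<exists>n\<ge>\<kappa>. n \<in> {n. n \<ge> 2 \<and> n mod 2 = \<pi> \<and> total n \<noteq> 0 \<and> slog \<theta> n < enat (Q n)}"
      using n(1) by (intro exI[of _ n]) auto
  qed
  then show ?thesis using \<theta> unfolding Q_def by blast
qed

end

text \<open>
  A common denominator \<open>d\<close> of all coefficients and bases makes the family integral: multiplying \<open>s(n)\<close> by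
  \<open>d\<close> to the power \<open>1 + n + \<dots> + n^l\<close> replaces each base and each coefficient by its product with \<open>d\<close>. The bases at
  indices outside \<open>{1..l}\<close> are normalised to \<open>1\<close> so that distinct functions are distinct vectors of bases.
\<close>

lemma rational_family_many_primes:
  fixes Y :: "(nat \<Rightarrow> rat) set" and c :: "(nat \<Rightarrow> rat) \<Rightarrow> rat" and s :: "nat \<Rightarrow> rat"
  assumes Y: "finite Y" "card Y \<ge> 2"
    and pos: "\<And>y j. y \<in> Y \<Longrightarrow> j \<in> {1..l} \<Longrightarrow> y j > 0"
    and normal: "\<And>y j. y \<in> Y \<Longrightarrow> j \<notin> {1..l} \<Longrightarrow> y j = 1"
    and c: "\<And>y. y \<in> Y \<Longrightarrow> c y \<noteq> 0"
    and \<pi>: "\<pi> < 2"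
    and s: "\<And>n. n \<ge> 1 \<Longrightarrow> n mod 2 = \<pi> \<Longrightarrow> s n = (\<Sum>y\<in>Y. c y * (\<Prod>j=1..l. y j ^ (n ^ j)))"
  shows "\<exists>\<theta>>1. infinite {n. n \<ge> 2 \<and> slog \<theta> n < omega_rat (s n)}"
proof -
  have "finite (c ` Y \<union> (\<Union>y\<in>Y. y ` {1..l}))" using Y by auto
  then obtain d :: nat where d: "d > 0"
    and int: "\<And>a. a \<in> c ` Y \<union> (\<Union>y\<in>Y. y ` {1..l}) \<Longrightarrow> \<exists>z::int. a * of_nat d = of_int z"
    by (rule common_denominator) blast
  have "\<exists>z::int. c y * of_nat d = of_int z" if "y \<in> Y" for y using int that by blast
  then obtain C where C: "\<And>y. y \<in> Y \<Longrightarrow> c y * of_nat d = of_int (C y)" by metis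
  have "\<exists>z::nat. y j * of_nat d = of_nat z" if y: "y \<in> Y" "j \<in> {1..l}" for y j
  proof -
    obtain z :: int where z: "y j * of_nat d = of_int z" using int y by blast
    moreover have "y j * of_nat d > 0" using pos[OF y] d by simp
    ultimately have "z > 0" by simp
    then show ?thesis using z by (intro exI[of _ "nat z"]) simp
  qed
  then obtain w :: "(nat \<Rightarrow> rat) \<Rightarrow> nat \<Rightarrow> nat"
    where w: "\<And>y j. y \<in> Y \<Longrightarrow> j \<in> {1..l} \<Longrightarrow> y j * of_nat d = of_nat (w y j)" by metis
  have w_pos: "w y j > 0" if "y \<in> Y" "j \<in> {1..l}" for y j
    using w[OF that] pos[OF that] d by (metis mult_pos_pos of_nat_0_less_iff)
  interpret superpower_family l Y w C
  proof
    fix y assume y: "y \<in> Y"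
    have "of_int (C y) \<noteq> (0 :: rat)" using C[OF y] c[OF y] d by (metis mult_eq_0_iff of_nat_eq_0_iff less_irrefl)
    then show "C y \<noteq> 0" by auto
  next
    fix y y' assume y: "y \<in> Y" "y' \<in> Y" "y \<noteq> y'"
    then obtain j where j: "y j \<noteq> y' j" by blast
    then have j': "j \<in> {1..l}" using normal y by metis
    have "y j * of_nat d \<noteq> y' j * of_nat d" using j d by simp
    then have "w y j \<noteq> w y' j" using w y j' by metis
    then show "\<exists>j\<in>{1..l}. w y j \<noteq> w y' j" using j' by blast
  qed (use Y w_pos in auto)
  define P where "P = prime_factors d \<union> (\<Union>y\<in>Y. \<Union>j\<in>{1..l}. prime_factors (w y j))"
  have P: "finite P" "\<And>p. p \<in> P \<Longrightarrow> prime p" using Y by (auto simp: P_def)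
  have P_w: "p \<in> P" if p: "prime p" "y \<in> Y" "j \<in> {1..l}" "p dvd w y j" for p y j
  proof -
    have "p \<in> prime_factors (w y j)" using p w_pos[of y j] by (intro prime_factorsI) auto
    then show ?thesis using p unfolding P_def by blast
  qed
  have "\<exists>\<theta>>1. infinite {n. n \<ge> 2 \<and> n mod 2 = \<pi> \<and> total n \<noteq> 0 \<and>
      slog \<theta> n < enat (card (prime_factors (nat \<bar>total n\<bar>) - P))}"
    by (rule many_primes_at_tower_speed) (use P \<pi> P_w in blast)+
  then obtain \<theta> where \<theta>: "\<theta> > 1" "infinite {n. n \<ge> 2 \<and> n mod 2 = \<pi> \<and> total n \<noteq> 0 \<and>
    slog \<theta> n < enat (card (prime_factors (nat \<bar>total n\<bar>) - P))}"
    by blast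
  have "enat (card (prime_factors (nat \<bar>total n\<bar>) - P)) \<le> omega_rat (s n)"
    if n: "n \<ge> 2" "n mod 2 = \<pi>" "total n \<noteq> 0" for n
  proof (rule card_prime_factors_le_omega_rat[OF _ n(3)])
    let ?e = "\<Sum>j=1..l. n ^ j"
    have "s n * of_int (int d ^ Suc ?e) =
      (\<Sum>y\<in>Y. (c y * of_nat d) * ((\<Prod>j=1..l. y j ^ (n ^ j)) * (\<Prod>j=1..l. of_nat d ^ (n ^ j))))"
      using n s by (simp add: sum_distrib_right sum_distrib_left power_sum ac_simps)
    also have "\<dots> = (\<Sum>y\<in>Y. of_int (C y) * of_nat (superpower l (w y) n))"
    proof (intro sum.cong refl)
      fix y assume y: "y \<in> Y"
      have "(\<Prod>j=1..l. y j ^ (n ^ j)) * (\<Prod>j=1..l. of_nat d ^ (n ^ j)) = (\<Prod>j=1..l. (y j * of_nat d) ^ (n ^ j))"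
        by (simp add: power_mult_distrib prod.distrib)
      also have "\<dots> = (\<Prod>j=1..l. of_nat (w y j) ^ (n ^ j))"
        by (intro prod.cong refl) (simp only: w[OF y])
      also have "\<dots> = of_nat (superpower l (w y) n)" by (simp add: superpower_def)
      finally show "c y * of_nat d * ((\<Prod>j=1..l. y j ^ (n ^ j)) * (\<Prod>j=1..l. of_nat d ^ (n ^ j))) =
        of_int (C y) * of_nat (superpower l (w y) n)" using C[OF y] by simp
    qed
    also have "\<dots> = of_int (total n)" by (simp add: total_def)
    finally show "s n * of_int (int d ^ Suc ?e) = of_int (total n)" .
    fix p :: nat assume p: "prime p" "int p dvd int d ^ Suc ?e"
    have "prime (int p)" using p(1) by simp
    then have "int p dvd int d" using p(2) by (rule prime_dvd_power)
    then have "p \<in> prime_factors d" using p d by (intro prime_factorsI) auto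
    then show "p \<in> P" by (simp add: P_def)
  qed
  then have "{n. n \<ge> 2 \<and> n mod 2 = \<pi> \<and> total n \<noteq> 0 \<and>
      slog \<theta> n < enat (card (prime_factors (nat \<bar>total n\<bar>) - P))} \<subseteq> {n. n \<ge> 2 \<and> slog \<theta> n < omega_rat (s n)}"
    using less_le_trans by blast
  then show ?thesis using \<theta> infinite_super by blast
qed

section \<open>Parity classes\<close>

text \<open>
  For \<open>j \<ge> 1\<close> the power \<open>n^j\<close> has the parity of \<open>n\<close>, so the sign of a base contributes the same factor for
  all \<open>n\<close> in the class, and terms with the same absolute values can be collected. Terms with a vanishing base
  disappear, as do collected terms whose coefficients cancel.
\<close>

lemma superpower_sum_on_parity_class:
  obtains Y :: "(nat \<Rightarrow> rat) set" and c where "finite Y"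
    "\<And>y j. y \<in> Y \<Longrightarrow> j \<in> {1..l} \<Longrightarrow> y j > 0"
    "\<And>y j. y \<in> Y \<Longrightarrow> j \<notin> {1..l} \<Longrightarrow> y j = 1"
    "\<And>y. y \<in> Y \<Longrightarrow> c y \<noteq> 0"
    "\<And>n. n \<ge> 1 \<Longrightarrow> n mod 2 = \<pi> \<Longrightarrow>
      superpower_sum k l x n = (\<Sum>y\<in>Y. c y * (\<Prod>j=1..l. y j ^ (n ^ j)))"
proof -
  define J where "J = {i\<in>{1..k}. \<forall>j\<le>l. x i j \<noteq> 0}"
  define y where "y i = (\<lambda>j. if j \<in> {1..l} then \<bar>x i j\<bar> else 1)" for i
  define \<gamma> where "\<gamma> i = x i 0 * (\<Prod>j=1..l. sgn (x i j) ^ \<pi>)" for i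
  define c where "c v = (\<Sum>i\<in>{i\<in>J. y i = v}. \<gamma> i)" for v
  have J: "finite J" by (simp add: J_def)
  have zero: "(\<Prod>j=0..l. x i j ^ (n ^ j)) = 0" if "i \<in> {1..k} - J" "n \<ge> 1" for i n
    using that by (auto simp: J_def)
  have term_eq: "(\<Prod>j=0..l. x i j ^ (n ^ j)) = \<gamma> i * (\<Prod>j=1..l. y i j ^ (n ^ j))"
    if i: "i \<in> J" and n: "n mod 2 = \<pi>" for i n
  proof -
    have "x i j ^ (n ^ j) = sgn (x i j) ^ \<pi> * y i j ^ (n ^ j)" if j: "j \<in> {1..l}" for j
    proof -
      have nz: "x i j \<noteq> 0" using i j by (simp add: J_def)
      have par: "even (n ^ j) \<longleftrightarrow> even \<pi>" unfolding n[symmetric] using j by simp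
      have "sgn (x i j) = 1 \<or> sgn (x i j) = -1" using nz by (auto simp: sgn_if)
      then have sgn_eq: "sgn (x i j) ^ (n ^ j) = sgn (x i j) ^ \<pi>"
        using par minus_one_power_iff[of "n ^ j", where 'a = rat] minus_one_power_iff[of \<pi>, where 'a = rat]
        by (elim disjE) (simp_all only: power_one)
      have "x i j = sgn (x i j) * y i j" using j by (simp add: y_def sgn_mult_abs)
      from arg_cong[OF this, of "\<lambda>t. t ^ (n ^ j)"] show ?thesis
        unfolding power_mult_distrib sgn_eq .
    qed
    then have "(\<Prod>j=1..l. x i j ^ (n ^ j)) = (\<Prod>j=1..l. sgn (x i j) ^ \<pi> * y i j ^ (n ^ j))"
      by (intro prod.cong) auto
    then show ?thesis by (simp add: prod.atLeast_Suc_atMost \<gamma>_def prod.distrib)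
  qed
  show ?thesis
  proof (rule that[of "{v\<in>y ` J. c v \<noteq> 0}" c])
    fix n :: nat assume n: "n \<ge> 1" "n mod 2 = \<pi>"
    have "superpower_sum k l x n = (\<Sum>i\<in>J. \<Prod>j=0..l. x i j ^ (n ^ j))"
      unfolding superpower_sum_def
      by (rule sum.mono_neutral_right) (use zero n in \<open>auto simp: J_def\<close>)
    also have "\<dots> = (\<Sum>i\<in>J. \<gamma> i * (\<Prod>j=1..l. y i j ^ (n ^ j)))"
      by (intro sum.cong refl term_eq n)
    also have "\<dots> = (\<Sum>v\<in>y ` J. \<Sum>i\<in>{i\<in>J. y i = v}. \<gamma> i * (\<Prod>j=1..l. y i j ^ (n ^ j)))"
      using J by (rule sum.image_gen)
    also have "\<dots> = (\<Sum>v\<in>y ` J. c v * (\<Prod>j=1..l. v j ^ (n ^ j)))"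
      unfolding c_def sum_distrib_right by (intro sum.cong) auto
    also have "\<dots> = (\<Sum>v\<in>{v\<in>y ` J. c v \<noteq> 0}. c v * (\<Prod>j=1..l. v j ^ (n ^ j)))"
      using J by (intro sum.mono_neutral_right) auto
    finally show "superpower_sum k l x n = \<dots>" .
  qed (use J in \<open>auto simp: J_def y_def\<close>)
qed

lemma zero_has_infinite_omega: "omega_rat 0 = \<infinity>"
  by (simp add: omega_rat_def omega_int_def)

lemma zero_on_parity_class:
  assumes \<pi>: "\<pi> < 2" and s: "\<And>n. n \<ge> 1 \<Longrightarrow> n mod 2 = \<pi> \<Longrightarrow> s n = 0"
  shows "\<exists>\<theta>>1. infinite {n. n \<ge> 2 \<and> slog \<theta> n < omega_rat (s n)}"
proof -
  have grow: "real \<kappa> < tower 2 \<kappa>" for \<kappa>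
  proof (induction \<kappa>)
    case (Suc \<kappa>)
    have "Suc \<kappa> \<le> 2 ^ \<kappa>" using less_exp[of \<kappa>] by (rule Suc_leI)
    then have "real (Suc \<kappa>) \<le> real (2 ^ \<kappa>)" by (rule of_nat_mono)
    also have "\<dots> = 2 ^ \<kappa>" by simp
    also have "(2::real) ^ \<kappa> = 2 powr real \<kappa>" by (simp add: powr_realpow)
    also have "\<dots> < 2 powr tower 2 \<kappa>" using Suc by (intro powr_less_mono) auto
    finally show ?case by simp
  qed simp
  have "infinite {n. n \<ge> 2 \<and> slog 2 n < omega_rat (s n)}"
    unfolding infinite_nat_iff_unbounded_le
  proof
    fix m
    define n where "n = 2 * (m + 1) + \<pi>"
    have n_pos: "n > 0" by (simp add: n_def)
    have "s n = 0" using \<pi> by (intro s) (auto simp: n_def)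
    have "slog 2 n < enat n"
      by (rule slog_less) (use grow[of n] in \<open>simp_all add: n_def[symmetric] Suc_leI n_pos\<close>)
    also have "enat n < omega_rat (s n)" using \<open>s n = 0\<close> by (simp add: zero_has_infinite_omega)
    finally show "\<exists>n\<ge>m. n \<in> {n. n \<ge> 2 \<and> slog 2 n < omega_rat (s n)}"
      by (intro exI[of _ n]) (auto simp: n_def)
  qed
  then show ?thesis by (intro exI[of _ 2]) auto
qed

text \<open>
  The number of collected terms decides: none or at least two yield many primes, so exactly one is left.
\<close>

lemma single_superpower_if_few_primes:
  assumes \<pi>: "\<pi> < 2"
    and few: "\<not> (\<exists>\<theta>>1. infinite {n. n \<ge> 2 \<and> slog \<theta> n < omega_rat (superpower_sum k l x n)})"
  shows "\<exists>a :: nat \<Rightarrow> rat. (\<forall>j\<le>l. a j \<noteq> 0) \<and>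
    (\<forall>n\<ge>1. n mod 2 = \<pi> \<longrightarrow> superpower_sum k l x n = (\<Prod>j=0..l. a j ^ (n ^ j)))"
proof -
  obtain Y :: "(nat \<Rightarrow> rat) set" and c where Y: "finite Y"
    and pos: "\<And>y j. y \<in> Y \<Longrightarrow> j \<in> {1..l} \<Longrightarrow> y j > 0"
    and normal: "\<And>y j. y \<in> Y \<Longrightarrow> j \<notin> {1..l} \<Longrightarrow> y j = 1"
    and c: "\<And>y. y \<in> Y \<Longrightarrow> c y \<noteq> 0"
    and s: "\<And>n. n \<ge> 1 \<Longrightarrow> n mod 2 = \<pi> \<Longrightarrow>
      superpower_sum k l x n = (\<Sum>y\<in>Y. c y * (\<Prod>j=1..l. y j ^ (n ^ j)))"
    by (rule superpower_sum_on_parity_class[of l \<pi> k x]) blast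
  consider "card Y = 0" | "card Y = 1" | "card Y \<ge> 2" by linarith
  then show ?thesis
  proof cases
    case 1
    then have "Y = {}" using Y by simp
    then have "superpower_sum k l x n = 0" if "n \<ge> 1" "n mod 2 = \<pi>" for n
      using s[OF that] by simp
    then show ?thesis using few zero_on_parity_class[OF \<pi>] by blast
  next
    case 2
    then obtain y where y: "Y = {y}" using card_1_singletonE by blast
    define a where "a j = (if j = 0 then c y else y j)" for j
    have "a j \<noteq> 0" if "j \<le> l" for j
      using c[of y] pos[of y j] y that by (cases "j = 0") (auto simp: a_def)
    moreover have "superpower_sum k l x n = (\<Prod>j=0..l. a j ^ (n ^ j))" if "n \<ge> 1" "n mod 2 = \<pi>" for n
    proof -
      have "(\<Prod>j=1..l. a j ^ (n ^ j)) = (\<Prod>j=1..l. y j ^ (n ^ j))"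
        by (intro prod.cong) (auto simp: a_def)
      moreover have "{0..l} = insert 0 {1..l}" by auto
      ultimately show ?thesis using s[OF that] y by (simp add: a_def)
    qed
    ultimately show ?thesis by blast
  next
    case 3
    have "\<exists>\<theta>>1. infinite {n. n \<ge> 2 \<and> slog \<theta> n < omega_rat (superpower_sum k l x n)}"
      by (rule rational_family_many_primes[where Y = Y and c = c and l = l and \<pi> = \<pi>
          and s = "superpower_sum k l x"]) (fact Y 3 pos normal c \<pi> s)+
    then show ?thesis using few by contradiction
  qed
qed

theorem theorem1:
  fixes k l :: nat and x :: "nat \<Rightarrow> nat \<Rightarrow> rat" and s :: "nat \<Rightarrow> rat"
  defines "s \<equiv> superpower_sum k l x"
  assumes "k \<ge> 1" and "l \<ge> 1"
  shows
    "((\<exists>\<theta>::real. \<theta> > 1 \<and> infinite {n::nat. n \<ge> 2 \<and> omega_rat (s n) > slog \<theta> n})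
        \<longleftrightarrow> limsup (\<lambda>n. omega_rat (s n)) = \<infinity>)
     \<and> (limsup (\<lambda>n. omega_rat (s n)) = \<infinity>
        \<longleftrightarrow> \<not> (\<exists>a b :: nat \<Rightarrow> rat.
              (\<forall>j\<le>l. a j \<noteq> 0 \<and> b j \<noteq> 0) \<and>
              (\<forall>n\<ge>1. s (2 * n) = (\<Prod>j=0..l. a j ^ ((2 * n) ^ j)) \<and>
                      s (2 * n - 1) = (\<Prod>j=0..l. b j ^ ((2 * n - 1) ^ j)))))"
    (is "(?a \<longleftrightarrow> ?b) \<and> (?b \<longleftrightarrow> \<not> ?rep)")
proof -
  have ab: "?b" if a: "?a"
    unfolding limsup_eq_infinity_iff
  proof
    fix m
    obtain \<theta> where \<theta>: "\<theta> > 1" "infinite {n::nat. n \<ge> 2 \<and> omega_rat (s n) > slog \<theta> n}" using a by blast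
    have "\<exists>\<^sub>F n in sequentially. omega_rat (s n) > slog \<theta> n"
    proof -
      have "infinite {n. omega_rat (s n) > slog \<theta> n}"
        using \<theta>(2) by (rule infinite_super[rotated]) auto
      then show ?thesis by (simp add: frequently_cofinite flip: cofinite_eq_sequentially)
    qed
    moreover have "\<forall>\<^sub>F n in sequentially. tower \<theta> m \<le> real n"
      using filterlim_real_sequentially unfolding filterlim_at_top by blast
    ultimately have "\<exists>\<^sub>F n in sequentially. slog \<theta> n < omega_rat (s n) \<and> tower \<theta> m \<le> real n"
      by (rule frequently_eventually_frequently)
    then show "\<exists>\<^sub>F n in sequentially. enat m < omega_rat (s n)"
      by (rule frequently_elim1) (use slog_ge le_less_trans in blast)
  qed
  have bc: "\<not> ?rep" if b: "?b"
  proof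
    assume ?rep
    then obtain a b :: "nat \<Rightarrow> rat" where nz: "\<And>j. j \<le> l \<Longrightarrow> a j \<noteq> 0" "\<And>j. j \<le> l \<Longrightarrow> b j \<noteq> 0"
      and rep: "\<And>n. n \<ge> 1 \<Longrightarrow> s (2 * n) = (\<Prod>j=0..l. a j ^ ((2 * n) ^ j))"
        "\<And>n. n \<ge> 1 \<Longrightarrow> s (2 * n - 1) = (\<Prod>j=0..l. b j ^ ((2 * n - 1) ^ j))"
      by blast
    obtain A where A: "\<And>e. omega_rat (\<Prod>j=0..l. a j ^ e j) \<le> enat A"
      by (rule omega_rat_superpower_bounded[of l a]) (use nz in auto)
    obtain B where B: "\<And>e. omega_rat (\<Prod>j=0..l. b j ^ e j) \<le> enat B"
      by (rule omega_rat_superpower_bounded[of l b]) (use nz in auto)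
    have "\<forall>\<^sub>F n in sequentially. \<not> enat (max A B) < omega_rat (s n)"
      using eventually_ge_at_top[of 1]
    proof eventually_elim
      case (elim n)
      consider m where "n = 2 * m" "m \<ge> 1" | m where "n = 2 * m - 1" "m \<ge> 1"
      proof (cases "even n")
        case True
        then show ?thesis using that(1)[of "n div 2"] elim by auto
      next
        case False
        then show ?thesis using that(2)[of "(n + 1) div 2"] elim by (auto elim!: oddE)
      qed
      then have "omega_rat (s n) \<le> enat A \<or> omega_rat (s n) \<le> enat B"
        using rep A B by cases metis+
      then have "omega_rat (s n) \<le> enat (max A B)"
        by (meson enat_ord_simps(1) max.cobounded1 max.cobounded2 order_trans)
      then show ?case by simp
    qed
    then show False using b unfolding limsup_eq_infinity_iff frequently_def by blast
  qed
  have ca: "?a" if c: "\<not> ?rep"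
  proof (rule ccontr)
    assume not_a: "\<not> ?a"
    have single: "\<exists>a :: nat \<Rightarrow> rat. (\<forall>j\<le>l. a j \<noteq> 0) \<and>
      (\<forall>n\<ge>1. n mod 2 = \<pi> \<longrightarrow> s n = (\<Prod>j=0..l. a j ^ (n ^ j)))" if "\<pi> < 2" for \<pi>
      using not_a unfolding s_def by (intro single_superpower_if_few_primes that)
    obtain a :: "nat \<Rightarrow> rat" where a: "\<forall>j\<le>l. a j \<noteq> 0"
        "\<forall>n\<ge>1. n mod 2 = 0 \<longrightarrow> s n = (\<Prod>j=0..l. a j ^ (n ^ j))"
    proof -
      have "(0::nat) < 2" by simp
      from single[OF this] show ?thesis using that by blast
    qed
    obtain b :: "nat \<Rightarrow> rat" where b: "\<forall>j\<le>l. b j \<noteq> 0"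
        "\<forall>n\<ge>1. n mod 2 = 1 \<longrightarrow> s n = (\<Prod>j=0..l. b j ^ (n ^ j))"
    proof -
      have "(1::nat) < 2" by simp
      from single[OF this] show ?thesis using that by blast
    qed
    have "s (2 * n) = (\<Prod>j=0..l. a j ^ ((2 * n) ^ j)) \<and>
        s (2 * n - 1) = (\<Prod>j=0..l. b j ^ ((2 * n - 1) ^ j))" if n: "n \<ge> 1" for n
    proof -
      have "(2 * n - 1) mod 2 = 1" "2 * n - 1 \<ge> 1" "(2 * n) mod 2 = 0" "2 * n \<ge> 1"
        using n by presburger+
      then show ?thesis
        using a(2)[rule_format, of "2 * n"] b(2)[rule_format, of "2 * n - 1"] by simp
    qed
    then show False using c a(1) b(1) by blast
  qed
  show ?thesis using ab bc ca by blast
qed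

end
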